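(* Let $n\ge 3$ be an integer, let $1<p\le\infty$ and let $q$ be its conjugate exponent ($1/p+1/q=1$). Let $\alpha,\beta\in\mathbb{R}$ satisfy $n+\alpha=\beta+1$ and $\beta\ge n$. Let $\varphi\in L^{p}(\mathbb{S}^{n-1},\mathbb{R}^{n})$ and let $$u(x)=u_{\alpha,\beta}[\varphi](x)=c_{n,\beta}\int_{\mathbb{S}^{n-1}}\frac{(1-|x|^{2})^{\alpha}}{|x-\eta|^{\beta}}\,\varphi(\eta)\,d\sigma(\eta),\qquad x\in\mathbb{B}^n.$$ Then for every $x\in\mathbb{B}^{n}$, $$|u(x)|\le \frac{C_{p}(x)}{(1-|x|^{2})^{(n-1)/p}}\,\|\varphi\|_{L^{p}},\qquad C_{p}(x)=c_{n,\beta}\left(F\Big(\frac{n-q\beta}{2},\, n-1-\frac{q\beta}{2};\,\frac{n}{2};\, |x|^{2}\Big)\right)^{1/q},$$ and this inequality is sharp: for each fixed $x\in\mathbb{B}^n$, $C_p(x)$ cannot be replaced by any smaller number (equality is attained for some $\varphi\in L^p(\mathbb{S}^{n-1},\mathbb{R}^n)$, $\varphi\neq 0$).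
   Context: $\mathbb{B}^n$ is the open unit ball of $\mathbb{R}^n$ with Euclidean norm $|\cdot|$, $\mathbb{S}^{n-1}$ its boundary sphere, and $\sigma$ the surface measure on $\mathbb{S}^{n-1}$ normalized so that $\sigma(\mathbb{S}^{n-1})=1$; $\|\varphi\|_{L^p}=\left(\int_{\mathbb{S}^{n-1}}|\varphi|^p\,d\sigma\right)^{1/p}$ (essential supremum if $p=\infty$). The constant is $c_{n,\beta}=\frac{\Gamma(\frac{\beta}{2})\Gamma(\frac{\beta}{2}-\frac{n}{2}+1)}{\Gamma(\frac{n}{2})\Gamma(\beta-n+1)}$. $F(a,b;c;t)=\sum_{k\ge0}\frac{(a)_k(b)_k}{(c)_k}\frac{t^k}{k!}$ is the Gauss hypergeometric function, with $(a)_k=\Gamma(a+k)/\Gamma(a)$ (Pochhammer symbol). *)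

theory Defs
  imports "HOL-Analysis.Analysis" "HOL-Probability.Essential_Supremum"
begin

text \<open>Normalized surface measure on the unit sphere of a Euclidean space, realised as the
cone measure: push-forward of the normalized Lebesgue measure on the unit ball under radial
projection (the point 0, a null set, is sent to a fixed basis vector).\<close>
definition sphere_measure :: "'a::euclidean_space measure" where
  "sphere_measure = distr (uniform_measure lborel (ball 0 1))
     (restrict_space borel (sphere 0 1))
     (\<lambda>x. if x = 0 then (SOME b. b \<in> Basis) else x /\<^sub>R norm x)"

definition Lp_norm :: "'b measure \<Rightarrow> ereal \<Rightarrow> ('b \<Rightarrow> 'c::real_normed_vector) \<Rightarrow> real" where
  "Lp_norm M p f =
     (if p = \<infinity> then real_of_ereal (esssup M (\<lambda>y. ereal (norm (f y))))
      else (\<integral>y. norm (f y) powr real_of_ereal p \<partial>M) powr (1 / real_of_ereal p))"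

definition in_Lp :: "'b measure \<Rightarrow> ereal \<Rightarrow> ('b \<Rightarrow> 'c::{real_normed_vector, second_countable_topology}) \<Rightarrow> bool" where
  "in_Lp M p f \<longleftrightarrow> f \<in> borel_measurable M \<and>
     (if p = \<infinity> then esssup M (\<lambda>y. ereal (norm (f y))) < \<infinity>
      else integrable M (\<lambda>y. norm (f y) powr real_of_ereal p))"

definition conj_exp :: "ereal \<Rightarrow> real" where
  "conj_exp p = (if p = \<infinity> then 1 else real_of_ereal p / (real_of_ereal p - 1))"

definition inv_exp :: "ereal \<Rightarrow> real" where
  "inv_exp p = (if p = \<infinity> then 0 else 1 / real_of_ereal p)"

definition c_const :: "real \<Rightarrow> real \<Rightarrow> real" where
  "c_const n \<beta> = Gamma (\<beta> / 2) * Gamma (\<beta> / 2 - n / 2 + 1) / (Gamma (n / 2) * Gamma (\<beta> - n + 1))"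

definition hypgeom :: "real \<Rightarrow> real \<Rightarrow> real \<Rightarrow> real \<Rightarrow> real" where
  "hypgeom a b c t = (\<Sum>k. pochhammer a k * pochhammer b k / pochhammer c k * t ^ k / fact k)"

definition u_ab :: "real \<Rightarrow> real \<Rightarrow> ('a::euclidean_space \<Rightarrow> 'a) \<Rightarrow> 'a \<Rightarrow> 'a" where
  "u_ab \<alpha> \<beta> \<phi> x = c_const (real DIM('a)) \<beta> *\<^sub>R
     (\<integral>\<eta>. ((1 - (norm x)\<^sup>2) powr \<alpha> / norm (x - \<eta>) powr \<beta>) *\<^sub>R \<phi> \<eta> \<partial>sphere_measure)"

definition C_p :: "real \<Rightarrow> ereal \<Rightarrow> real \<Rightarrow> 'a::real_normed_vector \<Rightarrow> real" where
  "C_p n p \<beta> x = c_const n \<beta> *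
     hypgeom ((n - conj_exp p * \<beta>) / 2) (n - 1 - conj_exp p * \<beta> / 2) (n / 2) ((norm x)\<^sup>2)
       powr (1 / conj_exp p)"

end

theory Submission
  imports Defs "HOL-Probability.Probability_Measure" "HOL-Real_Asymp.Real_Asymp"
begin

text \<open>By Hoelder's inequality, the norm of the functional \<open>\<phi> \<mapsto> u(x)\<close> on vector-valued \<open>L\<^sup>p\<close> is the \<open>L\<^sup>q\<close>
  norm of its scalar kernel, and it is attained at \<open>K powr (q - 1)\<close> times a constant unit vector. It
  remains to evaluate the integral of \<open>|x - \<eta>| powr (- 2 \<lambda>)\<close> over the sphere as
  \<open>(1 - r\<^sup>2) powr (n - 1 - 2 \<lambda>) * F(n/2 - \<lambda>, n - 1 - \<lambda>; n/2; r\<^sup>2)\<close>, where \<open>r = |x|\<close>. Differentiating in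
  \<open>r\<close> expresses the derivative of the integral through the integral for \<open>\<lambda> + 1\<close>; the infinitesimal
  rotation invariance of the surface measure (integration by parts on the sphere) gives a three-term
  relation between \<open>\<lambda>\<close>, \<open>\<lambda> + 1\<close> and \<open>\<lambda> + 2\<close>. Hence both sides solve the same second-order equation on
  \<open>(0, 1)\<close>. Their weighted Wronskian is constant and vanishes at the singular point \<open>0\<close>, so their
  quotient is constant, and both are \<open>1\<close> at \<open>r = 0\<close>.\<close>

section \<open>Rotation invariance of the surface measure\<close>

text \<open>This expresses the uniqueness of translation-invariant measures without normalization constants:
  both sides equal the double integral of \<open>(x, y) \<mapsto> indicator A x * indicator B (x + y)\<close> with
  respect to \<open>M\<close> and \<open>lborel\<close>, evaluated in the two possible orders.\<close>

lemma translation_invariant_product: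
  fixes M :: "'a::euclidean_space measure"
  assumes sets_M: "sets M = sets borel" and "sigma_finite_measure M"
    and transl: "\<And>a. distr M borel ((+) a) = M"
    and A[measurable]: "A \<in> sets borel" and B[measurable]: "B \<in> sets borel"
  shows "emeasure M A * emeasure lborel B = emeasure M B * emeasure lborel (uminus -` A)"
proof -
  interpret M: sigma_finite_measure M by fact
  interpret L: sigma_finite_measure "lborel :: 'a measure" by (rule lborel.sigma_finite_measure_axioms)
  interpret P: pair_sigma_finite M "lborel :: 'a measure" ..
  note [measurable_cong] = sets_M
  have "(\<integral>\<^sup>+y. \<integral>\<^sup>+x. indicator A x * indicator B (x + y) \<partial>M \<partial>lborel)
      = (\<integral>\<^sup>+x. \<integral>\<^sup>+y. indicator A x * indicator B (x + y) \<partial>lborel \<partial>M)"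
    by (rule P.Fubini') measurable
  also have "\<dots> = (\<integral>\<^sup>+x. indicator A x * emeasure lborel B \<partial>M)"
  proof (rule nn_integral_cong)
    fix x :: 'a
    have "(\<integral>\<^sup>+y. indicator A x * indicator B (x + y) \<partial>lborel)
        = indicator A x * (\<integral>\<^sup>+y. indicator B (x + y) \<partial>lborel)"
      by (rule nn_integral_cmult) measurable
    also have "(\<integral>\<^sup>+y. indicator B (x + y) \<partial>lborel)
        = (\<integral>\<^sup>+y. indicator B y \<partial>distr lborel borel ((+) x))"
      by (subst nn_integral_distr) auto
    finally show "(\<integral>\<^sup>+y. indicator A x * indicator B (x + y) \<partial>lborel) = indicator A x * emeasure lborel B"
      by (simp add: lborel_distr_plus)
  qed
  also have "\<dots> = emeasure M A * emeasure lborel B"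
    by (subst nn_integral_multc) (auto simp: sets_M)
  finally have 1: "(\<integral>\<^sup>+y. \<integral>\<^sup>+x. indicator A x * indicator B (x + y) \<partial>M \<partial>lborel)
      = emeasure M A * emeasure lborel B" .
  have "(\<integral>\<^sup>+y. \<integral>\<^sup>+x. indicator A x * indicator B (x + y) \<partial>M \<partial>lborel)
      = (\<integral>\<^sup>+y. \<integral>\<^sup>+x. indicator A (x - y) * indicator B x \<partial>M \<partial>lborel)"
  proof (rule nn_integral_cong)
    fix y :: 'a
    have "(\<integral>\<^sup>+x. indicator A (x - y) * indicator B x \<partial>M)
        = (\<integral>\<^sup>+x. indicator A (x - y) * indicator B x \<partial>distr M borel ((+) y))"
      by (simp add: transl)
    also have "\<dots> = (\<integral>\<^sup>+x. indicator A x * indicator B (x + y) \<partial>M)"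
      by (subst nn_integral_distr) (auto simp: add.commute)
    finally show "(\<integral>\<^sup>+x. indicator A x * indicator B (x + y) \<partial>M)
        = (\<integral>\<^sup>+x. indicator A (x - y) * indicator B x \<partial>M)" by simp
  qed
  also have "\<dots> = (\<integral>\<^sup>+x. \<integral>\<^sup>+y. indicator A (x - y) * indicator B x \<partial>lborel \<partial>M)"
    by (rule P.Fubini') measurable
  also have "\<dots> = (\<integral>\<^sup>+x. emeasure lborel (uminus -` A) * indicator B x \<partial>M)"
  proof (rule nn_integral_cong)
    fix x :: 'a
    have "(\<integral>\<^sup>+y. indicator A (x - y) * indicator B x \<partial>lborel)
        = (\<integral>\<^sup>+y. indicator A (x - y) \<partial>lborel) * indicator B x"
      by (rule nn_integral_multc) measurable
    also have "(\<integral>\<^sup>+y. indicator A (x - y) \<partial>lborel)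
        = (\<integral>\<^sup>+y. indicator A (x - y) \<partial>distr lborel borel ((+) x))"
      by (simp add: lborel_distr_plus)
    also have "\<dots> = (\<integral>\<^sup>+y. indicator (uminus -` A) y \<partial>lborel)"
      by (subst nn_integral_distr) (auto simp: indicator_def intro!: nn_integral_cong)
    also have "\<dots> = emeasure lborel (uminus -` A)"
    proof (rule nn_integral_indicator)
      have "uminus -` A \<inter> space borel \<in> sets (borel :: 'a measure)"
        by (rule measurable_sets[OF _ A]) measurable
      then show "uminus -` A \<in> sets lborel" by simp
    qed
    finally show "(\<integral>\<^sup>+y. indicator A (x - y) * indicator B x \<partial>lborel)
        = emeasure lborel (uminus -` A) * indicator B x" .
  qed
  also have "\<dots> = emeasure M B * emeasure lborel (uminus -` A)"
    by (subst nn_integral_cmult) (auto simp: sets_M mult.commute)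
  finally show ?thesis using 1 by simp
qed

lemma emeasure_unit_ball_nonzero_finite:
  "emeasure lborel (ball (0::'a::euclidean_space) 1) \<noteq> 0"
  "emeasure lborel (ball (0::'a::euclidean_space) 1) \<noteq> \<infinity>"
proof -
  show "emeasure lborel (ball (0::'a) 1) \<noteq> \<infinity>"
    using emeasure_bounded_finite[of "ball (0::'a) 1"] by auto
  have "measure lborel (ball (0::'a) 1) > 0"
    using content_ball_pos[of 1 "0::'a"] by simp
  then show "emeasure lborel (ball (0::'a) 1) \<noteq> 0"
    by (auto simp: measure_def)
qed

lemma borel_measurable_orthogonal:
  fixes T :: "'a::euclidean_space \<Rightarrow> 'a"
  assumes "orthogonal_transformation T"
  shows "T \<in> borel_measurable borel"
  by (rule borel_measurable_continuous_onI)
    (use assms in \<open>auto simp: orthogonal_transformation intro: linear_continuous_on linear_conv_bounded_linear[THEN iffD1]\<close>)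

text \<open>The image of \<open>lborel\<close> under \<open>T\<close> is again translation
  invariant, since translating by \<open>a\<close> after \<open>T\<close> is the same as applying
  \<open>T\<close> after translating by \<open>inv T a\<close>. It also gives the unit ball its
  Lebesgue measure. Using the symmetric unit ball as the test set \<open>A\<close> in
  \<open>translation_invariant_product\<close> and cancelling its positive finite measure gives
  equality on every Borel set.\<close>

lemma lborel_distr_orthogonal:
  fixes T :: "'a::euclidean_space \<Rightarrow> 'a"
  assumes T: "orthogonal_transformation T"
  shows "distr lborel borel T = lborel"
proof (rule measure_eqI)
  have lin: "linear T" and nT: "norm (T x) = norm x" for x
    using T by (auto simp: orthogonal_transformation)
  have [measurable]: "T \<in> borel_measurable borel"
    by (rule borel_measurable_orthogonal[OF T])
  let ?S = "inv T"
  have S: "orthogonal_transformation ?S"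
    by (rule orthogonal_transformation_inv[OF T])
  have [measurable]: "?S \<in> borel_measurable borel"
    by (rule borel_measurable_orthogonal[OF S])
  have TS: "T (?S x) = x" for x
    using orthogonal_transformation_surj[OF T] by (simp add: surj_f_inv_f)
  let ?M = "distr lborel borel T"
  show "sets ?M = sets lborel" by simp
  have ball: "emeasure ?M (ball 0 r) = emeasure lborel (ball (0::'a) r)" for r
  proof -
    have "T -` ball 0 r = ball 0 r" by (auto simp: nT)
    then show ?thesis by (subst emeasure_distr) auto
  qed
  have "sigma_finite_measure ?M"
  proof
    show "\<exists>A::'a set set. countable A \<and> A \<subseteq> sets ?M \<and> \<Union>A = space ?M \<and> (\<forall>a\<in>A. emeasure ?M a \<noteq> \<infinity>)"
    proof (intro exI[of _ "range (\<lambda>n::nat. ball 0 (real n))"] conjI ballI)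
      show "\<Union> (range (\<lambda>n::nat. ball (0::'a) (real n))) = space ?M"
        using reals_Archimedean2 by auto
      fix a :: "'a set" assume "a \<in> range (\<lambda>n::nat. ball 0 (real n))"
      then obtain n :: nat where "a = ball 0 (real n)" by auto
      then show "emeasure ?M a \<noteq> \<infinity>"
        using emeasure_bounded_finite[of "ball (0::'a) (real n)"] by (simp add: ball)
    qed auto
  qed
  moreover have "distr ?M borel ((+) a) = ?M" for a
  proof -
    have "distr ?M borel ((+) a) = distr lborel borel ((+) a \<circ> T)"
      by (rule distr_distr) auto
    also have "(+) a \<circ> T = T \<circ> (+) (?S a)"
      by (auto simp: fun_eq_iff linear_add[OF lin] TS)
    also have "distr lborel borel (T \<circ> (+) (?S a)) = distr (distr lborel borel ((+) (?S a))) borel T"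
      by (rule distr_distr[symmetric]) auto
    finally show ?thesis by (simp add: lborel_distr_plus)
  qed
  ultimately have *: "emeasure ?M (ball 0 1) * emeasure lborel B
      = emeasure ?M B * emeasure lborel (uminus -` ball (0::'a) 1)" if "B \<in> sets borel" for B
    using that by (intro translation_invariant_product) auto
  fix B assume "B \<in> sets ?M"
  then have "emeasure lborel (ball (0::'a) 1) * emeasure lborel B
      = emeasure ?M B * emeasure lborel (uminus -` ball (0::'a) 1)"
    using * ball by simp
  also have "uminus -` ball (0::'a) 1 = ball 0 1" by auto
  finally show "emeasure ?M B = emeasure lborel B"
    using emeasure_unit_ball_nonzero_finite[where 'a='a]
    by (metis ennreal_mult_cancel_left mult.commute infinity_ennreal_def)
qed

text \<open>The projection inside \<open>sphere_measure\<close>. Its value at 0 is a unit vector, so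
  that it maps into the sphere everywhere and not just almost everywhere.\<close>

definition radial :: "'a::euclidean_space \<Rightarrow> 'a" where
  "radial x = (if x = 0 then SOME b. b \<in> Basis else x /\<^sub>R norm x)"

lemma radial_in_sphere: "radial x \<in> sphere 0 1"
  using some_in_eq[of "Basis :: 'a::euclidean_space set"]
  by (auto simp: radial_def nonempty_Basis)

lemma measurable_radial[measurable]:
  "radial \<in> lborel \<rightarrow>\<^sub>M restrict_space borel (sphere 0 1)"
proof -
  have "radial \<in> lborel \<rightarrow>\<^sub>M borel"
    unfolding radial_def by measurable
  then show ?thesis
    by (intro measurable_restrict_space2) (use radial_in_sphere in auto)
qed

lemma sphere_measure_eq_distr:
  "sphere_measure = distr (uniform_measure lborel (ball 0 1)) (restrict_space borel (sphere 0 1)) radial"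
  by (simp add: sphere_measure_def radial_def[abs_def])

lemma space_sphere_measure[simp]: "space sphere_measure = sphere 0 1"
  by (simp add: sphere_measure_eq_distr space_restrict_space)

lemma sets_sphere_measure[measurable_cong]: 
  "sets sphere_measure = sets (restrict_space borel (sphere 0 1))"
  by (simp add: sphere_measure_eq_distr)

lemma prob_space_sphere_measure: "prob_space (sphere_measure :: 'a::euclidean_space measure)"
proof -
  interpret prob_space "uniform_measure lborel (ball (0::'a) 1)"
    using emeasure_unit_ball_nonzero_finite by (intro prob_space_uniform_measure) auto
  show ?thesis
    unfolding sphere_measure_eq_distr by (rule prob_space_distr) simp
qed

text \<open>An orthogonal map sends the ball onto itself, so restricting Lebesgue measure to the
  ball and normalizing it commutes with \<open>T\<close>.\<close>

lemma uniform_ball_distr_orthogonal: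
  fixes T :: "'a::euclidean_space \<Rightarrow> 'a"
  assumes T: "orthogonal_transformation T"
  shows "distr (uniform_measure lborel (ball 0 1)) borel T = uniform_measure lborel (ball 0 1)"
proof (rule measure_eqI)
  have nT: "norm (T x) = norm x" for x
    using T by (auto simp: orthogonal_transformation)
  have mT[measurable]: "T \<in> borel_measurable borel"
    by (rule borel_measurable_orthogonal[OF T])
  fix B :: "'a set" assume "B \<in> sets (distr (uniform_measure lborel (ball 0 1)) borel T)"
  then have B[measurable]: "B \<in> sets borel" by simp
  have vB[measurable]: "T -` B \<in> sets borel"
    using measurable_sets[OF mT B] by simp
  have "ball 0 1 \<inter> T -` B = T -` (ball 0 1 \<inter> B)" by (auto simp: nT)
  then have "emeasure lborel (ball 0 1 \<inter> T -` B) = emeasure (distr lborel borel T) (ball 0 1 \<inter> B)"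
    by (subst emeasure_distr) auto
  also have "\<dots> = emeasure lborel (ball 0 1 \<inter> B)"
    by (simp add: lborel_distr_orthogonal[OF T])
  finally show "emeasure (distr (uniform_measure lborel (ball 0 1)) borel T) B
      = emeasure (uniform_measure lborel (ball 0 1)) B"
    by (subst emeasure_distr) auto
qed simp

text \<open>Radial projection commutes with \<open>T\<close> away from the origin, so the invariance
  passes from the uniform measure on the ball to its push-forward.\<close>

lemma sphere_measure_distr_orthogonal:
  fixes T :: "'a::euclidean_space \<Rightarrow> 'a"
  assumes T: "orthogonal_transformation T"
  shows "distr sphere_measure (restrict_space borel (sphere 0 1)) T = sphere_measure"
proof -
  let ?U = "uniform_measure lborel (ball (0::'a) 1)" and ?R = "restrict_space borel (sphere (0::'a) 1)"
  have lin: "linear T" and nT: "norm (T x) = norm x" for x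
    using T by (auto simp: orthogonal_transformation)
  have mT[measurable]: "T \<in> borel_measurable borel"
    by (rule borel_measurable_orthogonal[OF T])
  have mTR[measurable]: "T \<in> ?R \<rightarrow>\<^sub>M ?R"
    by (intro measurable_restrict_space3) (auto simp: nT)
  have "distr sphere_measure ?R T = distr ?U ?R (T \<circ> radial)"
    unfolding sphere_measure_eq_distr by (rule distr_distr) simp_all
  also have "\<dots> = distr ?U ?R (radial \<circ> T)"
  \<comment> \<open>At the origin \<open>radial\<close> takes an arbitrary basis vector, which
    \<open>T\<close> may move; the two compositions are therefore compared only almost
    everywhere.\<close>
  proof (rule distr_cong_AE)
    have "AE x in lborel. x \<noteq> (0::'a)"
      by (rule AE_lborel_singleton)
    then show "AE x in ?U. (T \<circ> radial) x = (radial \<circ> T) x"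
    proof (intro AE_uniform_measureI, goal_cases)
      case 2
      then show ?case
      proof eventually_elim
        case (elim x)
        moreover from this have "T x \<noteq> 0" using nT[of x] by auto
        ultimately show ?case by (simp add: radial_def linear_cmul[OF lin] nT)
      qed
    qed simp
  qed (auto intro!: measurable_comp[where N=borel] measurable_comp[where N="?R"])
  also have "\<dots> = distr (distr ?U borel T) ?R radial"
    by (rule distr_distr[symmetric]) auto
  finally show ?thesis
    by (simp add: uniform_ball_distr_orthogonal[OF T] sphere_measure_eq_distr)
qed

section \<open>Continuous functions on the sphere and differentiation under the integral
  sign\<close>

lemma sphere_continuous_measurable:
  fixes f :: "'a::euclidean_space \<Rightarrow> 'b::topological_space"
  assumes "continuous_on (sphere 0 1) f"
  shows "f \<in> borel_measurable sphere_measure"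
  using borel_measurable_continuous_on_restrict[OF assms]
  by (simp cong: measurable_cong_sets add: sets_sphere_measure)

lemma sphere_continuous_integrable:
  fixes f :: "'a::euclidean_space \<Rightarrow> 'b::euclidean_space"
  assumes f: "continuous_on (sphere 0 1) f"
  shows "integrable sphere_measure f"
proof -
  interpret prob_space "sphere_measure :: 'a measure" by (rule prob_space_sphere_measure)
  have "bounded (f ` sphere 0 1)"
    by (intro compact_imp_bounded compact_continuous_image f) simp
  then obtain B where "\<forall>y\<in>sphere 0 1. norm (f y) \<le> B"
    by (auto simp: bounded_iff)
  then show ?thesis
    by (intro integrable_const_bound[of _ B] sphere_continuous_measurable f) auto
qed

lemma integral_sphere_orthogonal:
  fixes f :: "'a::euclidean_space \<Rightarrow> real" and T :: "'a \<Rightarrow> 'a"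
  assumes T: "orthogonal_transformation T" and f: "continuous_on (sphere 0 1) f"
  shows "(\<integral>\<eta>. f (T \<eta>) \<partial>sphere_measure) = (\<integral>\<eta>. f \<eta> \<partial>sphere_measure)"
proof -
  let ?R = "restrict_space borel (sphere (0::'a) 1)"
  have nT: "norm (T x) = norm x" for x
    using T by (auto simp: orthogonal_transformation)
  have mT: "T \<in> borel_measurable borel"
    by (rule borel_measurable_orthogonal[OF T])
  have "T \<in> ?R \<rightarrow>\<^sub>M ?R"
    by (intro measurable_restrict_space3 mT) (auto simp: nT)
  then have "T \<in> sphere_measure \<rightarrow>\<^sub>M ?R"
    by (simp cong: measurable_cong_sets add: sets_sphere_measure)
  then have "(\<integral>\<eta>. f (T \<eta>) \<partial>sphere_measure) = (\<integral>\<eta>. f \<eta> \<partial>distr sphere_measure ?R T)"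
    using borel_measurable_continuous_on_restrict[OF f] by (simp add: integral_distr)
  then show ?thesis by (simp add: sphere_measure_distr_orthogonal[OF T])
qed

text \<open>Dominated convergence for difference quotients: compactness of
  \<open>cball r0 d \<times> sphere 0 1\<close> bounds \<open>f'\<close>, the mean value inequality
  carries the bound over to the quotients, and a constant is an integrable majorant for a
  probability measure.\<close>

lemma DERIV_integral_sphere:
  fixes f f' :: "real \<Rightarrow> 'a::euclidean_space \<Rightarrow> real"
  assumes d: "d > 0"
    and deriv: "\<And>r \<eta>. r \<in> cball r0 d \<Longrightarrow> \<eta> \<in> sphere 0 1 \<Longrightarrow> ((\<lambda>r. f r \<eta>) has_real_derivative f' r \<eta>) (at r)"
    and f: "\<And>r. r \<in> cball r0 d \<Longrightarrow> continuous_on (sphere 0 1) (f r)"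
    and f': "continuous_on (cball r0 d \<times> sphere 0 1) (\<lambda>(r, \<eta>). f' r \<eta>)"
  shows "((\<lambda>r. \<integral>\<eta>. f r \<eta> \<partial>sphere_measure) has_real_derivative (\<integral>\<eta>. f' r0 \<eta> \<partial>sphere_measure)) (at r0)"
proof -
  interpret prob_space "sphere_measure :: 'a measure" by (rule prob_space_sphere_measure)
  have "bounded ((\<lambda>(r, \<eta>). f' r \<eta>) ` (cball r0 d \<times> sphere 0 1))"
    by (intro compact_imp_bounded compact_continuous_image f' compact_Times) auto
  then obtain B where B: "\<And>r \<eta>. r \<in> cball r0 d \<Longrightarrow> \<eta> \<in> sphere 0 1 \<Longrightarrow> \<bar>f' r \<eta>\<bar> \<le> B"
    by (fastforce simp: bounded_iff)
  have f'0: "continuous_on (sphere 0 1) (f' r0)"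
  proof -
    have "continuous_on (sphere (0::'a) 1) (\<lambda>\<eta>. (r0, \<eta>))"
      by (intro continuous_on_Pair continuous_on_const continuous_on_id)
    moreover have "(\<lambda>\<eta>. (r0, \<eta>)) ` sphere 0 1 \<subseteq> cball r0 d \<times> sphere (0::'a) 1"
      using d by auto
    ultimately have "continuous_on (sphere 0 1) (\<lambda>\<eta>. (\<lambda>(r, \<eta>). f' r \<eta>) (r0, \<eta>))"
      by (rule continuous_on_compose2[OF f'])
    then show ?thesis by simp
  qed
  have "((\<lambda>r. ((\<integral>\<eta>. f r \<eta> \<partial>sphere_measure) - (\<integral>\<eta>. f r0 \<eta> \<partial>sphere_measure)) / (r - r0))
      \<longlongrightarrow> (\<integral>\<eta>. f' r0 \<eta> \<partial>sphere_measure)) (at r0 within ball r0 d)"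
    unfolding tendsto_at_iff_sequentially
  proof (intro allI impI)
    fix X :: "nat \<Rightarrow> real" assume X: "\<forall>i. X i \<in> ball r0 d - {r0}" and lim: "X \<longlonglongrightarrow> r0"
    have Xc: "X i \<in> cball r0 d" "X i \<noteq> r0" for i using X[rule_format, of i] by auto
    have r0c: "r0 \<in> cball r0 d" using d by simp
    let ?q = "\<lambda>i \<eta>. (f (X i) \<eta> - f r0 \<eta>) / (X i - r0)"
    have "(\<lambda>i. \<integral>\<eta>. ?q i \<eta> \<partial>sphere_measure) \<longlonglongrightarrow> (\<integral>\<eta>. f' r0 \<eta> \<partial>sphere_measure)"
    proof (rule integral_dominated_convergence[where w="\<lambda>_. B"])
      show "f' r0 \<in> borel_measurable sphere_measure"
        by (rule sphere_continuous_measurable[OF f'0])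
      show "?q i \<in> borel_measurable sphere_measure" for i
        using Xc[of i] r0c by (intro sphere_continuous_measurable continuous_intros f) auto
      show "AE \<eta> in sphere_measure. (\<lambda>i. ?q i \<eta>) \<longlonglongrightarrow> f' r0 \<eta>"
      proof (rule AE_I2)
        fix \<eta> :: 'a assume "\<eta> \<in> space sphere_measure"
        then have "((\<lambda>r. f r \<eta>) has_real_derivative f' r0 \<eta>) (at r0)"
          by (intro deriv r0c) simp
        then have "((\<lambda>r. (f r \<eta> - f r0 \<eta>) / (r - r0)) \<longlongrightarrow> f' r0 \<eta>) (at r0)"
          by (simp add: has_field_derivative_iff)
        then show "(\<lambda>i. ?q i \<eta>) \<longlonglongrightarrow> f' r0 \<eta>"
          unfolding tendsto_at_iff_sequentially using Xc lim by (auto simp: comp_def)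
      qed
      show "AE \<eta> in sphere_measure. norm (?q i \<eta>) \<le> B" for i
      proof (rule AE_I2)
        fix \<eta> :: 'a assume \<eta>: "\<eta> \<in> space sphere_measure"
        have "norm (f (X i) \<eta> - f r0 \<eta>) \<le> B * norm (X i - r0)"
        proof (rule field_differentiable_bound[of "cball r0 d" _ "\<lambda>r. f' r \<eta>"])
          fix z assume z: "z \<in> cball r0 d"
          then show "((\<lambda>r. f r \<eta>) has_real_derivative f' z \<eta>) (at z within cball r0 d)"
            using \<eta> by (auto intro: has_field_derivative_at_within[OF deriv])
          show "norm (f' z \<eta>) \<le> B"
            using B[OF z] \<eta> by simp
        qed (fact convex_cball Xc r0c)+
        then show "norm (?q i \<eta>) \<le> B"
          using Xc(2)[of i] by (simp add: norm_divide divide_le_eq)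
      qed
    qed simp
    moreover have "(\<integral>\<eta>. ?q i \<eta> \<partial>sphere_measure)
        = ((\<integral>\<eta>. f (X i) \<eta> \<partial>sphere_measure) - (\<integral>\<eta>. f r0 \<eta> \<partial>sphere_measure)) / (X i - r0)" for i
    proof -
      have "integrable sphere_measure (f (X i))" "integrable sphere_measure (f r0)"
        by (intro sphere_continuous_integrable f Xc r0c)+
      then show ?thesis by simp
    qed
    ultimately show "((\<lambda>r. ((\<integral>\<eta>. f r \<eta> \<partial>sphere_measure) - (\<integral>\<eta>. f r0 \<eta> \<partial>sphere_measure)) / (r - r0)) \<circ> X)
        \<longlonglongrightarrow> (\<integral>\<eta>. f' r0 \<eta> \<partial>sphere_measure)"
      by (simp only: comp_def)
  qed
  then show ?thesis
    using d at_within_open[of r0 "ball r0 d"] by (simp add: has_field_derivative_iff)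
qed

section \<open>Integration by parts on the sphere\<close>

text \<open>For distinct basis vectors this turns \<open>i\<close> towards \<open>j\<close> by the
  angle \<open>\<theta>\<close>. Writing it as the identity plus a correction in the plane of
  \<open>i\<close> and \<open>j\<close> leaves the orthogonal complement untouched.\<close>

definition plane_rotation :: "'a::euclidean_space \<Rightarrow> 'a \<Rightarrow> real \<Rightarrow> 'a \<Rightarrow> 'a" where
  "plane_rotation i j \<theta> y = y + ((cos \<theta> - 1) * (y \<bullet> i) - sin \<theta> * (y \<bullet> j)) *\<^sub>R i
     + (sin \<theta> * (y \<bullet> i) + (cos \<theta> - 1) * (y \<bullet> j)) *\<^sub>R j"

lemma plane_rotation_0 [simp]: "plane_rotation i j 0 y = y"
  by (simp add: plane_rotation_def)

lemma orthogonal_plane_rotation: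
  assumes "i \<in> Basis" "j \<in> Basis" "i \<noteq> j"
  shows "orthogonal_transformation (plane_rotation i j \<theta>)"
  unfolding orthogonal_transformation_def
proof (intro conjI allI)
  show "linear (plane_rotation i j \<theta>)"
    by (rule linearI) (simp_all add: plane_rotation_def algebra_simps)
  have ij: "i \<bullet> j = 0" "j \<bullet> i = 0" "i \<bullet> i = 1" "j \<bullet> j = 1"
    using assms by (auto simp: inner_not_same_Basis)
  fix v w :: 'a
  have *: "(v + a *\<^sub>R i + b *\<^sub>R j) \<bullet> (w + c *\<^sub>R i + d *\<^sub>R j)
      = v \<bullet> w + c * (v \<bullet> i) + d * (v \<bullet> j) + a * (w \<bullet> i) + b * (w \<bullet> j) + a * c + b * d" for a b c d
    by (simp add: inner_add_left inner_add_right ij inner_commute[of _ w] distrib_left)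
  have "plane_rotation i j \<theta> v \<bullet> plane_rotation i j \<theta> w
      = v \<bullet> w + ((cos \<theta>)\<^sup>2 + (sin \<theta>)\<^sup>2 - 1) * ((v \<bullet> i) * (w \<bullet> i) + (v \<bullet> j) * (w \<bullet> j))"
    unfolding plane_rotation_def * by algebra
  then show "plane_rotation i j \<theta> v \<bullet> plane_rotation i j \<theta> w = v \<bullet> w" by simp
qed

text \<open>The velocity of a rotating point is the infinitesimal rotation applied to its current
  position. Expressing it through the rotated point gives one formula for all angles.\<close>

lemma inner_plane_rotation_has_derivative:
  assumes "i \<in> Basis" "j \<in> Basis" "i \<noteq> j"
  shows "((\<lambda>\<theta>. x \<bullet> plane_rotation i j \<theta> y) has_real_derivative
     (x \<bullet> j) * (plane_rotation i j \<theta> y \<bullet> i) - (x \<bullet> i) * (plane_rotation i j \<theta> y \<bullet> j)) (at \<theta>)"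
proof -
  have ij: "i \<bullet> j = 0" "j \<bullet> i = 0" "i \<bullet> i = 1" "j \<bullet> j = 1"
    using assms by (auto simp: inner_not_same_Basis)
  have eq: "(\<lambda>\<theta>. x \<bullet> plane_rotation i j \<theta> y) = (\<lambda>\<theta>. x \<bullet> y
      + ((cos \<theta> - 1) * (y \<bullet> i) - sin \<theta> * (y \<bullet> j)) * (x \<bullet> i)
      + (sin \<theta> * (y \<bullet> i) + (cos \<theta> - 1) * (y \<bullet> j)) * (x \<bullet> j))"
    by (simp add: plane_rotation_def inner_add_right)
  show ?thesis
    unfolding eq
    by (auto intro!: derivative_eq_intros simp: plane_rotation_def inner_add_left ij algebra_simps)
qed

text \<open>Cauchy-Schwarz confines \<open>x \<bullet> \<eta>\<close> to the interval on which
  \<open>f\<close> is continuous.\<close>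

lemma continuous_on_sphere_inner:
  fixes x :: "'a::euclidean_space"
  assumes "continuous_on {-norm x..norm x} f"
  shows "continuous_on (sphere 0 1) (\<lambda>\<eta>. f (x \<bullet> \<eta>))"
proof (rule continuous_on_compose2[OF assms])
  show "(\<lambda>\<eta>. x \<bullet> \<eta>) ` sphere 0 1 \<subseteq> {-norm x..norm x}"
  proof safe
    fix \<eta> :: 'a assume "\<eta> \<in> sphere 0 1"
    then have "\<bar>x \<bullet> \<eta>\<bar> \<le> norm x"
      using Cauchy_Schwarz_ineq2[of x \<eta>] by simp
    then show "x \<bullet> \<eta> \<in> {-norm x..norm x}" by (simp add: abs_le_iff)
  qed
qed (intro continuous_intros)

text \<open>By rotation invariance the integral of
  \<open>(\<eta> \<bullet> j) * f (x \<bullet> \<eta>)\<close>, taken at the rotated point, is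
  constant in the angle. Its derivative at angle 0 is the integral in question.\<close>

lemma sphere_integration_by_parts_plane:
  fixes x :: "'a::euclidean_space"
  assumes ij: "i \<in> Basis" "j \<in> Basis" "i \<noteq> j"
    and f: "\<And>s. \<bar>s\<bar> \<le> norm x \<Longrightarrow> (f has_real_derivative f' s) (at s)"
    and f': "continuous_on {-norm x..norm x} f'"
  shows "(\<integral>\<eta>. (\<eta> \<bullet> i) * f (x \<bullet> \<eta>)
     + (\<eta> \<bullet> j) * f' (x \<bullet> \<eta>) * ((x \<bullet> j) * (\<eta> \<bullet> i) - (x \<bullet> i) * (\<eta> \<bullet> j)) \<partial>sphere_measure) = 0"
    (is "(\<integral>\<eta>. ?h \<eta> \<partial>sphere_measure) = 0")
proof -
  let ?R = "plane_rotation i j"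
  let ?G = "\<lambda>\<eta>. (\<eta> \<bullet> j) * f (x \<bullet> \<eta>)"
  have nR: "norm (?R \<theta> y) = norm y" for \<theta> y
    using orthogonal_plane_rotation[OF ij] by (auto simp: orthogonal_transformation)
  have xs: "\<bar>x \<bullet> \<eta>\<bar> \<le> norm x" if "\<eta> \<in> sphere 0 1" for \<eta>
    using Cauchy_Schwarz_ineq2[of x \<eta>] that by simp
  have "continuous_on {-norm x..norm x} f"
    by (rule DERIV_continuous_on, rule has_field_derivative_at_within, rule f) auto
  then have cf: "continuous_on (sphere 0 1) (\<lambda>\<eta>. f (x \<bullet> \<eta>))"
    by (rule continuous_on_sphere_inner)
  have cf': "continuous_on (sphere 0 1) (\<lambda>\<eta>. f' (x \<bullet> \<eta>))"
    by (rule continuous_on_sphere_inner[OF f'])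
  have cG: "continuous_on (sphere 0 1) ?G"
    by (intro continuous_intros cf)
  have ch: "continuous_on (sphere 0 1) ?h"
    by (intro continuous_intros cf cf')
  have "((\<lambda>\<theta>. \<integral>\<eta>. ?G (?R \<theta> \<eta>) \<partial>sphere_measure) has_real_derivative
      (\<integral>\<eta>. ?h (?R 0 \<eta>) \<partial>sphere_measure)) (at 0)"
  proof (rule DERIV_integral_sphere[where d=1])
    fix \<theta> :: real and \<eta> :: 'a assume \<eta>: "\<eta> \<in> sphere 0 1"
    then have "\<bar>x \<bullet> ?R \<theta> \<eta>\<bar> \<le> norm x" by (intro xs) (simp add: nR)
    then have "((\<lambda>\<theta>. f (x \<bullet> ?R \<theta> \<eta>)) has_real_derivative
        f' (x \<bullet> ?R \<theta> \<eta>) * ((x \<bullet> j) * (?R \<theta> \<eta> \<bullet> i) - (x \<bullet> i) * (?R \<theta> \<eta> \<bullet> j))) (at \<theta>)"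
      by (intro DERIV_chain2[OF f] inner_plane_rotation_has_derivative ij)
    moreover have "((\<lambda>\<theta>. ?R \<theta> \<eta> \<bullet> j) has_real_derivative ?R \<theta> \<eta> \<bullet> i) (at \<theta>)"
      using inner_plane_rotation_has_derivative[OF ij, of j \<eta> \<theta>] ij
      by (simp add: inner_commute inner_not_same_Basis)
    ultimately show "((\<lambda>\<theta>. ?G (?R \<theta> \<eta>)) has_real_derivative ?h (?R \<theta> \<eta>)) (at \<theta>)"
      by (auto intro!: derivative_eq_intros)
  next
    fix \<theta> :: real
    show "continuous_on (sphere 0 1) (\<lambda>\<eta>. ?G (?R \<theta> \<eta>))"
      by (rule continuous_on_compose2[OF cG])
        (auto simp: nR, auto simp: plane_rotation_def intro!: continuous_intros)
  next
    show "continuous_on (cball 0 1 \<times> sphere 0 1) (\<lambda>(\<theta>, \<eta>). ?h (?R \<theta> \<eta>))"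
      unfolding case_prod_beta
      by (rule continuous_on_compose2[OF ch])
        (auto simp: nR, auto simp: plane_rotation_def intro!: continuous_intros)
  qed simp
  moreover have "(\<lambda>\<theta>. \<integral>\<eta>. ?G (?R \<theta> \<eta>) \<partial>sphere_measure) = (\<lambda>_. \<integral>\<eta>. ?G \<eta> \<partial>sphere_measure)"
    by (intro ext integral_sphere_orthogonal orthogonal_plane_rotation ij cG)
  ultimately have "((\<lambda>_::real. \<integral>\<eta>. ?G \<eta> \<partial>sphere_measure) has_real_derivative
      (\<integral>\<eta>. ?h \<eta> \<partial>sphere_measure)) (at 0)" by simp
  from DERIV_unique[OF this DERIV_const] show ?thesis .
qed

text \<open>For fixed \<open>x\<close>, summing the plane identities with weights \<open>x \<bullet> i\<close> over all pairs of distinct basis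
  vectors leaves only functions of \<open>x \<bullet> \<eta>\<close>.\<close>

lemma sphere_integration_by_parts:
  fixes x :: "'a::euclidean_space"
  assumes f: "\<And>s. \<bar>s\<bar> \<le> norm x \<Longrightarrow> (f has_real_derivative f' s) (at s)"
    and f': "continuous_on {-norm x..norm x} f'"
  shows "(\<integral>\<eta>. (real DIM('a) - 1) * (x \<bullet> \<eta>) * f (x \<bullet> \<eta>)
     - ((norm x)\<^sup>2 - (x \<bullet> \<eta>)\<^sup>2) * f' (x \<bullet> \<eta>) \<partial>sphere_measure) = 0"
proof -
  have "continuous_on {-norm x..norm x} f"
    by (rule DERIV_continuous_on, rule has_field_derivative_at_within, rule f) auto
  then have cf: "continuous_on (sphere 0 1) (\<lambda>\<eta>. f (x \<bullet> \<eta>))"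
    by (rule continuous_on_sphere_inner)
  have cf': "continuous_on (sphere 0 1) (\<lambda>\<eta>. f' (x \<bullet> \<eta>))"
    by (rule continuous_on_sphere_inner[OF f'])
  define h where "h i j \<eta> = (\<eta> \<bullet> i) * f (x \<bullet> \<eta>)
     + (\<eta> \<bullet> j) * f' (x \<bullet> \<eta>) * ((x \<bullet> j) * (\<eta> \<bullet> i) - (x \<bullet> i) * (\<eta> \<bullet> j))" for i j \<eta>
  \<comment> \<open>On the diagonal the \<open>f'\<close> term of \<open>h\<close> cancels, so the
    subtraction makes \<open>h' i i\<close> zero. The sums can then run over all pairs of basis
    vectors.\<close>
  define h' where "h' i j \<eta> = h i j \<eta> - (if i = j then (\<eta> \<bullet> i) * f (x \<bullet> \<eta>) else 0)" for i j \<eta>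
  have int: "integrable sphere_measure (h' i j)" for i j
  proof -
    have "integrable sphere_measure (h i j)"
      unfolding h_def by (intro sphere_continuous_integrable continuous_intros cf cf')
    moreover have "integrable sphere_measure (\<lambda>\<eta>. (\<eta> \<bullet> i) * f (x \<bullet> \<eta>))"
      by (intro sphere_continuous_integrable continuous_intros cf)
    ultimately show ?thesis
      unfolding h'_def by (cases "i = j") auto
  qed
  have zero: "(\<integral>\<eta>. h' i j \<eta> \<partial>sphere_measure) = 0" if "i \<in> Basis" "j \<in> Basis" for i j
  proof (cases "i = j")
    case True
    then have "h' i j = (\<lambda>_. 0)" by (simp add: h'_def[abs_def] h_def[abs_def])
    then show ?thesis by simp
  next
    case False
    then have "h' i j = h i j" by (simp add: h'_def[abs_def])
    then show ?thesis
      using sphere_integration_by_parts_plane[OF that False f f'] unfolding h_def by simp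
  qed
  have "(\<integral>\<eta>. (\<Sum>i\<in>Basis. \<Sum>j\<in>Basis. (x \<bullet> i) * h' i j \<eta>) \<partial>sphere_measure) = 0"
    by (subst Bochner_Integration.integral_sum, simp add: int,
        subst Bochner_Integration.integral_sum, simp add: int, simp add: zero)
  moreover have "(\<Sum>i\<in>Basis. \<Sum>j\<in>Basis. (x \<bullet> i) * h' i j \<eta>)
      = (real DIM('a) - 1) * (x \<bullet> \<eta>) * f (x \<bullet> \<eta>) - ((norm x)\<^sup>2 - (x \<bullet> \<eta>)\<^sup>2) * f' (x \<bullet> \<eta>)"
    if \<eta>: "\<eta> \<in> sphere 0 1" for \<eta>
  proof -
    let ?s = "x \<bullet> \<eta>"
    have s: "(\<Sum>i\<in>Basis. (x \<bullet> i) * (\<eta> \<bullet> i)) = ?s"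
      by (rule euclidean_inner[symmetric])
    have \<eta>1: "(\<Sum>i\<in>Basis. (\<eta> \<bullet> i)\<^sup>2) = 1"
      using \<eta> euclidean_inner[of \<eta> \<eta>] by (simp add: power2_eq_square norm_eq_1)
    have x2: "(\<Sum>i\<in>Basis. (x \<bullet> i)\<^sup>2) = (norm x)\<^sup>2"
      using euclidean_inner[of x x] by (simp add: power2_norm_eq_inner) (simp add: power2_eq_square)
    \<comment> \<open>The dimension is lowered by one because the diagonal term is missing;
      \<open>norm \<eta> = 1\<close> evaluates the sum of the squares
      \<open>(\<eta> \<bullet> j)\<^sup>2\<close>.\<close>
    have row: "(\<Sum>j\<in>Basis. h' i j \<eta>)
        = (real DIM('a) - 1) * (\<eta> \<bullet> i) * f ?s + f' ?s * (?s * (\<eta> \<bullet> i) - (x \<bullet> i))"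
      if i: "i \<in> Basis" for i
    proof -
      have "(\<Sum>j\<in>Basis. h' i j \<eta>) = (\<Sum>j\<in>Basis. (\<eta> \<bullet> i) * f ?s
          + f' ?s * (\<eta> \<bullet> i) * ((x \<bullet> j) * (\<eta> \<bullet> j)) - f' ?s * (x \<bullet> i) * (\<eta> \<bullet> j)\<^sup>2
          - (if i = j then (\<eta> \<bullet> i) * f ?s else 0))"
        by (intro sum.cong refl) (simp add: h'_def h_def power2_eq_square algebra_simps del: if_split)
      also have "\<dots> = real DIM('a) * ((\<eta> \<bullet> i) * f ?s) + f' ?s * (\<eta> \<bullet> i) * ?s - f' ?s * (x \<bullet> i)
          - (\<eta> \<bullet> i) * f ?s"
        unfolding sum.distrib sum_subtractf sum_distrib_left[symmetric] s \<eta>1 using i by simp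
      finally show ?thesis by (simp add: algebra_simps)
    qed
    have "(\<Sum>i\<in>Basis. \<Sum>j\<in>Basis. (x \<bullet> i) * h' i j \<eta>)
        = (\<Sum>i\<in>Basis. (real DIM('a) - 1) * f ?s * ((x \<bullet> i) * (\<eta> \<bullet> i))
          + f' ?s * ?s * ((x \<bullet> i) * (\<eta> \<bullet> i)) - f' ?s * (x \<bullet> i)\<^sup>2)"
      unfolding sum_distrib_left[symmetric]
      by (intro sum.cong refl) (simp add: row power2_eq_square algebra_simps)
    also have "\<dots> = (real DIM('a) - 1) * f ?s * ?s + f' ?s * ?s * ?s - f' ?s * (norm x)\<^sup>2"
      unfolding sum.distrib sum_subtractf sum_distrib_left[symmetric] s x2 ..
    finally show ?thesis by (simp add: power2_eq_square algebra_simps)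
  qed
  ultimately show ?thesis
    by (subst (asm) Bochner_Integration.integral_cong[OF refl]) simp_all
qed

section \<open>The kernel integral and the hypergeometric function\<close>

text \<open>\<open>sphere_kernel_integral e \<mu> r\<close> is the integral of \<open>|r e - \<eta>| powr (-2 \<mu>)\<close> over the unit sphere.\<close>

definition sphere_kernel_integral :: "'a::euclidean_space \<Rightarrow> real \<Rightarrow> real \<Rightarrow> real" where
  "sphere_kernel_integral e \<mu> r = (\<integral>\<eta>. (1 + r\<^sup>2 - 2 * r * (e \<bullet> \<eta>)) powr (-\<mu>) \<partial>sphere_measure)"

text \<open>By Cauchy-Schwarz the expression is at least
  \<open>(1 - \<bar>r\<bar>)\<^sup>2\<close>.\<close>

lemma sphere_kernel_base_pos:
  fixes e \<eta> :: "'a::real_inner"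
  assumes "norm e = 1" "norm \<eta> = 1" "\<bar>r\<bar> < 1"
  shows "0 < 1 + r\<^sup>2 - 2 * r * (e \<bullet> \<eta>)"
proof -
  have "r * (e \<bullet> \<eta>) \<le> \<bar>r\<bar> * \<bar>e \<bullet> \<eta>\<bar>"
    by (metis abs_ge_self abs_mult)
  also have "\<dots> \<le> \<bar>r\<bar> * 1"
    using Cauchy_Schwarz_ineq2[of e \<eta>] assms by (intro mult_left_mono) auto
  finally have "1 + r\<^sup>2 - 2 * r * (e \<bullet> \<eta>) \<ge> (1 - \<bar>r\<bar>)\<^sup>2"
    by (simp add: power2_eq_square algebra_simps)
  moreover have "(1 - \<bar>r\<bar>)\<^sup>2 > 0" using assms by simp
  ultimately show ?thesis by linarith
qed

lemma continuous_on_sphere_kernel: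
  fixes e :: "'a::euclidean_space"
  assumes "norm e = 1" "\<bar>r\<bar> < 1"
  shows "continuous_on (sphere 0 1) (\<lambda>\<eta>. (1 + r\<^sup>2 - 2 * r * (e \<bullet> \<eta>)) powr a)"
proof -
  have "1 + r\<^sup>2 - 2 * r * (e \<bullet> \<eta>) \<noteq> 0" if "\<eta> \<in> sphere 0 1" for \<eta>
    using sphere_kernel_base_pos[OF assms(1) _ assms(2), of \<eta>] that by simp
  then show ?thesis by (intro continuous_intros ballI)
qed

lemma sphere_kernel_integral_0:
  "sphere_kernel_integral (e::'a::euclidean_space) \<mu> 0 = 1"
proof -
  interpret prob_space "sphere_measure :: 'a measure" by (rule prob_space_sphere_measure)
  show ?thesis using prob_space by (simp add: sphere_kernel_integral_def)
qed

text \<open>A zero integral would force the strictly positive integrand to vanish almost everywhere.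
  Positivity later permits division by this integral.\<close>

lemma sphere_kernel_integral_pos:
  fixes e :: "'a::euclidean_space"
  assumes "norm e = 1" "\<bar>r\<bar> < 1"
  shows "sphere_kernel_integral e \<mu> r > 0"
proof -
  interpret prob_space "sphere_measure :: 'a measure" by (rule prob_space_sphere_measure)
  have pos: "(1 + r\<^sup>2 - 2 * r * (e \<bullet> \<eta>)) powr (-\<mu>) > 0" if "\<eta> \<in> sphere 0 1" for \<eta>
    using sphere_kernel_base_pos[of e \<eta> r] assms that by simp
  have "sphere_kernel_integral e \<mu> r \<noteq> 0"
  proof
    assume "sphere_kernel_integral e \<mu> r = 0"
    moreover have "integrable sphere_measure (\<lambda>\<eta>. (1 + r\<^sup>2 - 2 * r * (e \<bullet> \<eta>)) powr (-\<mu>))"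
      by (intro sphere_continuous_integrable continuous_on_sphere_kernel assms)
    ultimately have "AE \<eta> in sphere_measure. (1 + r\<^sup>2 - 2 * r * (e \<bullet> \<eta>)) powr (-\<mu>) = 0"
      unfolding sphere_kernel_integral_def by (subst (asm) integral_nonneg_eq_0_iff_AE) simp_all
    moreover have "AE \<eta> in sphere_measure. (1 + r\<^sup>2 - 2 * r * (e \<bullet> \<eta>)) powr (-\<mu>) > 0"
      by (rule AE_I2) (use pos in simp)
    ultimately have "AE \<eta> in (sphere_measure :: 'a measure). False"
      by eventually_elim linarith
    then show False by simp
  qed
  moreover have "sphere_kernel_integral e \<mu> r \<ge> 0"
    unfolding sphere_kernel_integral_def by simp
  ultimately show ?thesis by simp
qed

text \<open>Let u be the base of the power. Then r times its derivative in r is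
  \<open>u - (1 - r\<^sup>2)\<close>, so r times the derivative of the integrand splits into the
  powers with exponents \<open>-\<mu>\<close> and \<open>-(\<mu> + 1)\<close>. The formula is stated
  for \<open>r * D\<close> to avoid a division at \<open>r = 0\<close>, where the derivative still
  exists.\<close>

lemma sphere_kernel_integral_has_derivative:
  fixes e :: "'a::euclidean_space"
  assumes e: "norm e = 1" and r: "\<bar>r\<bar> < 1"
  obtains D where "(sphere_kernel_integral e \<mu> has_real_derivative D) (at r)"
    and "r * D = - \<mu> * sphere_kernel_integral e \<mu> r + \<mu> * (1 - r\<^sup>2) * sphere_kernel_integral e (\<mu> + 1) r"
proof
  let ?u = "\<lambda>r \<eta>. 1 + r\<^sup>2 - 2 * r * (e \<bullet> \<eta>)"
  let ?D = "\<lambda>r \<eta>. - \<mu> * ?u r \<eta> powr (-(\<mu> + 1)) * (2 * r - 2 * (e \<bullet> \<eta>))"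
  \<comment> \<open>Half the distance from \<open>\<bar>r\<bar>\<close> to 1, so that the closed
    interval around \<open>r\<close> stays inside the open interval from -1 to 1.\<close>
  define d where "d = (1 - \<bar>r\<bar>) / 2"
  have d: "\<bar>s\<bar> < 1" if "s \<in> cball r d" for s
    using that r by (auto simp: d_def dist_real_def abs_if split: if_splits)
  have d0: "d > 0" using r by (simp add: d_def)
  have pos: "?u s \<eta> > 0" if "s \<in> cball r d" "\<eta> \<in> sphere 0 1" for s \<eta>
    using that d by (intro sphere_kernel_base_pos e) auto
  have "((\<lambda>r. \<integral>\<eta>. ?u r \<eta> powr (-\<mu>) \<partial>sphere_measure) has_real_derivative
      (\<integral>\<eta>. ?D r \<eta> \<partial>sphere_measure)) (at r)"
  proof (rule DERIV_integral_sphere[OF d0])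
    fix s \<eta> assume "s \<in> cball r d" "\<eta> \<in> sphere (0::'a) 1"
    note u = pos[OF this]
    have "((\<lambda>r. ?u r \<eta>) has_real_derivative (2 * s - 2 * (e \<bullet> \<eta>))) (at s)"
      by (auto intro!: derivative_eq_intros)
    from DERIV_fun_powr[OF this u, of "-\<mu>"]
    show "((\<lambda>r. ?u r \<eta> powr (-\<mu>)) has_real_derivative ?D s \<eta>) (at s)"
      by simp
  next
    fix s assume "s \<in> cball r d"
    then show "continuous_on (sphere 0 1) (\<lambda>\<eta>. ?u s \<eta> powr (-\<mu>))"
      using d by (intro continuous_on_sphere_kernel e) auto
  next
    show "continuous_on (cball r d \<times> sphere 0 1) (\<lambda>(r, \<eta>). ?D r \<eta>)"
    proof -
      have "1 + (fst z)\<^sup>2 - 2 * fst z * (e \<bullet> snd z) \<noteq> 0" if "z \<in> cball r d \<times> sphere 0 1" for z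
        using pos[of "fst z" "snd z"] that by auto
      then show ?thesis
        unfolding case_prod_beta by (intro continuous_intros ballI)
    qed
  qed
  then show "(sphere_kernel_integral e \<mu> has_real_derivative (\<integral>\<eta>. ?D r \<eta> \<partial>sphere_measure)) (at r)"
    by (simp add: sphere_kernel_integral_def[abs_def])
  have int: "integrable sphere_measure (\<lambda>\<eta>. ?u r \<eta> powr a)" for a
    by (intro sphere_continuous_integrable continuous_on_sphere_kernel e r)
  have "r * (\<integral>\<eta>. ?D r \<eta> \<partial>sphere_measure) = (\<integral>\<eta>. r * ?D r \<eta> \<partial>sphere_measure)"
    by simp
  also have "\<dots> = (\<integral>\<eta>. (- \<mu>) * ?u r \<eta> powr (-\<mu>) + \<mu> * (1 - r\<^sup>2) * ?u r \<eta> powr (-(\<mu> + 1)) \<partial>sphere_measure)"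
  proof (rule Bochner_Integration.integral_cong[OF refl])
    fix \<eta> :: 'a assume "\<eta> \<in> space sphere_measure"
    then have u: "?u r \<eta> > 0" using pos d0 by simp
    then have "?u r \<eta> powr (-\<mu>) = ?u r \<eta> * ?u r \<eta> powr (-(\<mu> + 1))"
      by (simp add: powr_mult_base)
    moreover have "r * (2 * r - 2 * (e \<bullet> \<eta>)) = ?u r \<eta> - (1 - r\<^sup>2)"
      by (simp add: power2_eq_square algebra_simps)
    ultimately show "r * ?D r \<eta> = (- \<mu>) * ?u r \<eta> powr (-\<mu>) + \<mu> * (1 - r\<^sup>2) * ?u r \<eta> powr (-(\<mu> + 1))"
      by algebra
  qed
  also have "\<dots> = - \<mu> * sphere_kernel_integral e \<mu> r + \<mu> * (1 - r\<^sup>2) * sphere_kernel_integral e (\<mu> + 1) r"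
    unfolding sphere_kernel_integral_def
    by (subst Bochner_Integration.integral_add) (use int in \<open>auto simp del: minus_add_distrib\<close>)
  finally show "r * (\<integral>\<eta>. ?D r \<eta> \<partial>sphere_measure)
    = - \<mu> * sphere_kernel_integral e \<mu> r + \<mu> * (1 - r\<^sup>2) * sphere_kernel_integral e (\<mu> + 1) r" .
qed

text \<open>This is \<open>sphere_integration_by_parts\<close> for \<open>x = r *\<^sub>R e\<close>
  and the function \<open>?f\<close> below. Since \<open>x \<bullet> \<eta>\<close> is affine in the
  kernel base, both terms of the integrand become combinations of three consecutive powers of that
  base.\<close>

lemma sphere_kernel_integral_contiguous:
  fixes e :: "'a::euclidean_space" and l :: real
  defines "n \<equiv> real DIM('a)"
  assumes e: "norm e = 1" and r: "\<bar>r\<bar> < 1"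
  shows "(l + 1) * (1 - r\<^sup>2)\<^sup>2 * sphere_kernel_integral e (l + 2) r
    = (2 * l + 3 - n) * (1 + r\<^sup>2) * sphere_kernel_integral e (l + 1) r
      - (l + 2 - n) * sphere_kernel_integral e l r"
proof -
  let ?u = "\<lambda>\<eta>. 1 + r\<^sup>2 - 2 * r * (e \<bullet> \<eta>)"
  let ?v = "\<lambda>s. 1 + r\<^sup>2 - 2 * s"
  let ?f = "\<lambda>s. ?v s powr (-(l + 1))" and ?f' = "\<lambda>s. 2 * (l + 1) * ?v s powr (-(l + 2))"
  define x where "x = r *\<^sub>R e"
  have nx: "norm x = \<bar>r\<bar>" using e by (simp add: x_def)
  have xe: "x \<bullet> \<eta> = r * (e \<bullet> \<eta>)" for \<eta> by (simp add: x_def)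
  have vpos: "?v s > 0" if "\<bar>s\<bar> \<le> norm x" for s
  proof -
    have "0 < (1 - \<bar>r\<bar>)\<^sup>2" using r by simp
    also have "\<dots> = 1 + r\<^sup>2 - 2 * \<bar>r\<bar>" by (simp add: power2_eq_square algebra_simps)
    also have "\<dots> \<le> ?v s" using that nx by linarith
    finally show ?thesis .
  qed
  have int: "integrable sphere_measure (\<lambda>\<eta>. ?u \<eta> powr a)" for a
    by (intro sphere_continuous_integrable continuous_on_sphere_kernel e r)
  have "(\<integral>\<eta>. (n - 1) * (x \<bullet> \<eta>) * ?f (x \<bullet> \<eta>)
     - ((norm x)\<^sup>2 - (x \<bullet> \<eta>)\<^sup>2) * ?f' (x \<bullet> \<eta>) \<partial>sphere_measure) = 0"
    unfolding n_def
  proof (rule sphere_integration_by_parts)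
    fix s assume "\<bar>s\<bar> \<le> norm x"
    note v = vpos[OF this]
    have "(?v has_real_derivative -2) (at s)"
      by (auto intro!: derivative_eq_intros)
    from DERIV_fun_powr[OF this v, of "-(l + 1)"]
    show "(?f has_real_derivative ?f' s) (at s)"
      by (simp add: algebra_simps)
  next
    show "continuous_on {-norm x..norm x} ?f'"
    proof -
      have "?v s \<noteq> 0" if "s \<in> {-norm x..norm x}" for s
        using vpos[of s] that by (simp add: abs_le_iff)
      then show ?thesis by (intro continuous_intros ballI)
    qed
  qed
  also have "(\<integral>\<eta>. (n - 1) * (x \<bullet> \<eta>) * ?f (x \<bullet> \<eta>)
     - ((norm x)\<^sup>2 - (x \<bullet> \<eta>)\<^sup>2) * ?f' (x \<bullet> \<eta>) \<partial>sphere_measure)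
    = (\<integral>\<eta>. (l + 2 - n) / 2 * ?u \<eta> powr (-l)
        + ((n - 1) / 2 - (l + 1)) * (1 + r\<^sup>2) * ?u \<eta> powr (-(l + 1))
        + (l + 1) / 2 * (1 - r\<^sup>2)\<^sup>2 * ?u \<eta> powr (-(l + 2)) \<partial>sphere_measure)"
  proof (rule Bochner_Integration.integral_cong[OF refl])
    fix \<eta> :: 'a assume "\<eta> \<in> space sphere_measure"
    then have u: "?u \<eta> > 0" using sphere_kernel_base_pos[OF e _ r] by simp
    define P where "P = ?u \<eta> powr (-(l + 2))"
    define u where "u = ?u \<eta>"
    have 1: "?u \<eta> powr (-(l + 1)) = u * P"
      unfolding P_def u_def by (subst powr_mult_base) (use u in \<open>auto simp: algebra_simps\<close>)
    have 0: "?u \<eta> powr (-l) = u * (u * P)"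
      using u powr_mult_base[of "?u \<eta>" "-(l+1)"] unfolding 1[symmetric] by (simp add: u_def)
    \<comment> \<open>Consequently \<open>4 * (r\<^sup>2 - (x \<bullet> \<eta>)\<^sup>2) = 2 * (1 +
      r\<^sup>2) * u - u\<^sup>2 - (1 - r\<^sup>2)\<^sup>2\<close>, which is where the factor
      \<open>(1 - r\<^sup>2)\<^sup>2\<close> comes from.\<close>
    have s: "x \<bullet> \<eta> = (1 + r\<^sup>2 - u) / 2" by (simp add: u_def xe)
    have "?v (x \<bullet> \<eta>) = ?u \<eta>" by (simp add: xe)
    then have "(n - 1) * (x \<bullet> \<eta>) * ?f (x \<bullet> \<eta>) - ((norm x)\<^sup>2 - (x \<bullet> \<eta>)\<^sup>2) * ?f' (x \<bullet> \<eta>)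
        = (n - 1) * (x \<bullet> \<eta>) * (u * P) - (r\<^sup>2 - (x \<bullet> \<eta>)\<^sup>2) * (2 * (l + 1) * P)"
      using nx by (simp only: 1 power2_abs flip: P_def)
    also have "\<dots> = (l + 2 - n) / 2 * (u * (u * P))
        + ((n - 1) / 2 - (l + 1)) * (1 + r\<^sup>2) * (u * P) + (l + 1) / 2 * (1 - r\<^sup>2)\<^sup>2 * P"
      unfolding s by (simp add: power2_eq_square field_simps)
    finally show "(n - 1) * (x \<bullet> \<eta>) * ?f (x \<bullet> \<eta>) - ((norm x)\<^sup>2 - (x \<bullet> \<eta>)\<^sup>2) * ?f' (x \<bullet> \<eta>)
      = (l + 2 - n) / 2 * ?u \<eta> powr (-l)
        + ((n - 1) / 2 - (l + 1)) * (1 + r\<^sup>2) * ?u \<eta> powr (-(l + 1))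
        + (l + 1) / 2 * (1 - r\<^sup>2)\<^sup>2 * ?u \<eta> powr (-(l + 2))"
      by (simp only: 0 1 P_def)
  qed
  also have "\<dots> = (l + 2 - n) / 2 * sphere_kernel_integral e l r
        + ((n - 1) / 2 - (l + 1)) * (1 + r\<^sup>2) * sphere_kernel_integral e (l + 1) r
        + (l + 1) / 2 * (1 - r\<^sup>2)\<^sup>2 * sphere_kernel_integral e (l + 2) r"
    unfolding sphere_kernel_integral_def
    by (subst Bochner_Integration.integral_add Bochner_Integration.integral_mult_right_zero;
        (intro Bochner_Integration.integrable_add integrable_mult_right int)?)+ simp
  finally show ?thesis by (simp add: field_simps)
qed

section \<open>The Gauss hypergeometric series and its differential equation\<close>

definition hypgeom_coeff :: "real \<Rightarrow> real \<Rightarrow> real \<Rightarrow> nat \<Rightarrow> real" where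
  "hypgeom_coeff a b c k = pochhammer a k * pochhammer b k / (pochhammer c k * fact k)"

lemma hypgeom_eq_powser: "hypgeom a b c t = (\<Sum>k. hypgeom_coeff a b c k * t ^ k)"
  by (simp add: hypgeom_def hypgeom_coeff_def mult_ac)

lemma hypgeom_coeff_0 [simp]: "hypgeom_coeff a b c 0 = 1"
  by (simp add: hypgeom_coeff_def)

lemma hypgeom_0 [simp]: "hypgeom a b c 0 = 1"
  unfolding hypgeom_eq_powser by (subst powser_zero) simp

text \<open>Each Pochhammer symbol gains one linear factor. This form of the coefficient ratio
  serves both the ratio test and the differential equation.\<close>

lemma hypgeom_coeff_Suc:
  assumes "c > 0"
  shows "hypgeom_coeff a b c (Suc k) * ((real k + 1) * (real k + c))
    = (real k + a) * (real k + b) * hypgeom_coeff a b c k"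
proof -
  have "pochhammer c k > 0" using assms by (rule pochhammer_pos)
  moreover have "x * A * (y * B) / (p * C * (s * f)) * (s * C) = A * B * (x * y / (p * f))"
    if "p \<noteq> 0" "C \<noteq> 0" "s \<noteq> 0" "f \<noteq> 0" for x y A B C p s f :: real
    using that by simp
  from this[of "pochhammer c k" "real k + c" "real k + 1" "fact k"] calculation assms
  show ?thesis
    by (simp add: hypgeom_coeff_def pochhammer_Suc add.commute add_nonneg_eq_0_iff)
qed

text \<open>The ratio of consecutive coefficients tends to 1, so the ratio of consecutive terms is
  eventually below the midpoint of \<open>\<bar>t\<bar>\<close> and 1.\<close>

lemma summable_hypgeom:
  assumes c: "c > 0" and t: "\<bar>t\<bar> < 1"
  shows "summable (\<lambda>k. hypgeom_coeff a b c k * t ^ k)"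
proof -
  have "((\<lambda>k. \<bar>(real k + a) * (real k + b) / ((real k + 1) * (real k + c))\<bar> * \<bar>t\<bar>) \<longlongrightarrow> \<bar>1\<bar> * \<bar>t\<bar>) sequentially"
    by (intro tendsto_intros) real_asymp
  then have "eventually (\<lambda>k. \<bar>(real k + a) * (real k + b) / ((real k + 1) * (real k + c))\<bar> * \<bar>t\<bar>
      < (1 + \<bar>t\<bar>) / 2) sequentially"
    by (rule order_tendstoD) (use t in simp)
  then obtain N where N: "\<And>k. k \<ge> N \<Longrightarrow>
      \<bar>(real k + a) * (real k + b) / ((real k + 1) * (real k + c))\<bar> * \<bar>t\<bar> < (1 + \<bar>t\<bar>) / 2"
    by (auto simp: eventually_sequentially)
  show ?thesis
  proof (rule summable_ratio_test)
    show "(1 + \<bar>t\<bar>) / 2 < 1" using t by simp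
    fix k assume k: "k \<ge> N"
    let ?q = "(real k + a) * (real k + b) / ((real k + 1) * (real k + c))"
    have "hypgeom_coeff a b c (Suc k) = ?q * hypgeom_coeff a b c k"
    proof -
      have "(real k + 1) * (real k + c) \<noteq> 0" using c by (simp add: add_nonneg_eq_0_iff)
      then show ?thesis
        using hypgeom_coeff_Suc[OF c, of a b k] by (simp only: times_divide_eq_left nonzero_eq_divide_eq not_False_eq_True)
    qed
    then have "norm (hypgeom_coeff a b c (Suc k) * t ^ Suc k)
        = (\<bar>?q\<bar> * \<bar>t\<bar>) * norm (hypgeom_coeff a b c k * t ^ k)"
      by (simp only: real_norm_def abs_mult power_Suc mult_ac)
    also have "\<dots> \<le> (1 + \<bar>t\<bar>) / 2 * norm (hypgeom_coeff a b c k * t ^ k)"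
      by (intro mult_right_mono less_imp_le[OF N[OF k]] norm_ge_zero)
    finally show "norm (hypgeom_coeff a b c (Suc k) * t ^ Suc k)
        \<le> (1 + \<bar>t\<bar>) / 2 * norm (hypgeom_coeff a b c k * t ^ k)" .
  qed
qed

text \<open>\<open>F1\<close> and \<open>F2\<close> are the termwise derivatives. Comparing
  coefficients of \<open>t ^ k\<close>, the equation is exactly the recursion
  \<open>hypgeom_coeff_Suc\<close>: its left side yields the terms
  \<open>t * F2 t + c * F1 t\<close>, its right side all the others.\<close>

lemma hypgeom_ode:
  fixes a b c :: real
  assumes c: "c > 0"
  obtains F1 F2 where
    "\<And>t. \<bar>t\<bar> < 1 \<Longrightarrow> (hypgeom a b c has_real_derivative F1 t) (at t)"
    "\<And>t. \<bar>t\<bar> < 1 \<Longrightarrow> (F1 has_real_derivative F2 t) (at t)"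
    "\<And>t. \<bar>t\<bar> < 1 \<Longrightarrow> t * (1 - t) * F2 t + (c - (a + b + 1) * t) * F1 t - a * b * hypgeom a b c t = 0"
proof
  let ?h = "hypgeom_coeff a b c"
  define F1 where "F1 t = (\<Sum>k. diffs ?h k * t ^ k)" for t
  define F2 where "F2 t = (\<Sum>k. diffs (diffs ?h) k * t ^ k)" for t
  have s0: "summable (\<lambda>k. ?h k * t ^ k)" if "\<bar>t\<bar> < 1" for t
    using summable_hypgeom[OF c that] .
  have s1: "summable (\<lambda>k. diffs ?h k * t ^ k)" if "\<bar>t\<bar> < 1" for t
    by (rule termdiff_converges[of _ 1]) (use that s0 in auto)
  have s2: "summable (\<lambda>k. diffs (diffs ?h) k * t ^ k)" if "\<bar>t\<bar> < 1" for t
    by (rule termdiff_converges[of _ 1]) (use that s1 in auto)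
  show "(hypgeom a b c has_real_derivative F1 t) (at t)" if "\<bar>t\<bar> < 1" for t
    unfolding F1_def hypgeom_eq_powser[abs_def]
    by (rule termdiffs_strong'[of 1]) (use that s0 in auto)
  show "(F1 has_real_derivative F2 t) (at t)" if "\<bar>t\<bar> < 1" for t
    unfolding F2_def F1_def[abs_def]
    by (rule termdiffs_strong'[of 1]) (use that s1 in auto)
  fix t :: real assume t: "\<bar>t\<bar> < 1"
  have e0: "(\<lambda>k. ?h k * t ^ k) sums hypgeom a b c t"
    unfolding hypgeom_eq_powser by (rule summable_sums[OF s0[OF t]])
  have e1: "(\<lambda>k. diffs ?h k * t ^ k) sums F1 t"
    unfolding F1_def by (rule summable_sums[OF s1[OF t]])
  have e2: "(\<lambda>k. diffs (diffs ?h) k * t ^ k) sums F2 t"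
    unfolding F2_def by (rule summable_sums[OF s2[OF t]])
  \<comment> \<open>The Euler operator: differentiating and multiplying by \<open>t\<close>
    multiplies the \<open>k\<close>-th coefficient by \<open>k\<close>.\<close>
  have shift: "(\<lambda>k. real k * d k * t ^ k) sums (t * D)" if "(\<lambda>k. diffs d k * t ^ k) sums D" for d D
  proof -
    have "(\<lambda>k. real k * d k * t ^ (k - Suc 0)) sums D"
      using diffs_equiv[of d t] that by (simp add: sums_iff)
    then have "(\<lambda>k. t * (real k * d k * t ^ (k - Suc 0))) sums (t * D)"
      by (rule sums_mult)
    moreover have "t * (real k * d k * t ^ (k - Suc 0)) = real k * d k * t ^ k" for k
      by (cases k) auto
    ultimately show ?thesis by simp
  qed
  have e1': "(\<lambda>k. real k * ?h k * t ^ k) sums (t * F1 t)"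
    by (rule shift[OF e1])
  have e2': "(\<lambda>k. real k * diffs ?h k * t ^ k) sums (t * F2 t)"
    by (rule shift[OF e2])
  \<comment> \<open>Multiplying by one more \<open>t\<close> moves the index up by one; the new term
    at index 0 vanishes because of the factor \<open>real k\<close>.\<close>
  have e2'': "(\<lambda>k. real k * (real k - 1) * ?h k * t ^ k) sums (t * (t * F2 t))"
  proof -
    have "(\<lambda>k. t * (real k * diffs ?h k * t ^ k)) sums (t * (t * F2 t))"
      by (rule sums_mult[OF e2'])
    then have "(\<lambda>k. real (Suc k) * (real (Suc k) - 1) * ?h (Suc k) * t ^ Suc k) sums (t * (t * F2 t))"
      by (simp add: diffs_def mult_ac)
    then show ?thesis by (subst (asm) sums_Suc_iff) simp
  qed
  have "(\<lambda>k. real k * diffs ?h k * t ^ k + c * (diffs ?h k * t ^ k)) sums (t * F2 t + c * F1 t)"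
    by (intro sums_add sums_mult e2' e1)
  moreover have "(\<lambda>k. real k * (real k - 1) * ?h k * t ^ k + (a + b + 1) * (real k * ?h k * t ^ k)
      + a * b * (?h k * t ^ k)) sums (t * (t * F2 t) + (a + b + 1) * (t * F1 t) + a * b * hypgeom a b c t)"
    by (intro sums_add sums_mult e2'' e1' e0)
  moreover have "real k * diffs ?h k * t ^ k + c * (diffs ?h k * t ^ k)
      = real k * (real k - 1) * ?h k * t ^ k + (a + b + 1) * (real k * ?h k * t ^ k)
      + a * b * (?h k * t ^ k)" for k
  proof -
    have "real k * diffs ?h k * t ^ k + c * (diffs ?h k * t ^ k)
        = (?h (Suc k) * ((real k + 1) * (real k + c))) * t ^ k"
      by (simp add: diffs_def algebra_simps)
    then show ?thesis
      unfolding hypgeom_coeff_Suc[OF c] by (simp add: algebra_simps)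
  qed
  ultimately have "t * F2 t + c * F1 t
      = t * (t * F2 t) + (a + b + 1) * (t * F1 t) + a * b * hypgeom a b c t"
    by (simp only: sums_unique2)
  then show "t * (1 - t) * F2 t + (c - (a + b + 1) * t) * F1 t - a * b * hypgeom a b c t = 0"
    by (simp add: algebra_simps)
qed

text \<open>The quotient \<open>Q\<close> of the hypergeometric side by the kernel integral is shown
  to be constant with value 1 at 0. Instead of a second derivative of \<open>A\<close>, the argument
  uses a first-order system for \<open>A\<close> and its companion \<open>B\<close> with exponent
  parameter \<open>l + 1\<close>.\<close>

lemma sphere_kernel_integral_hypgeom:
  fixes e :: "'a::euclidean_space" and l r :: real
  defines "n \<equiv> real DIM('a)"
  assumes dim: "DIM('a) \<ge> 3" and e: "norm e = 1" and r: "0 \<le> r" "r < 1"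
  shows "sphere_kernel_integral e l r
    = (1 - r\<^sup>2) powr (n - 1 - 2 * l) * hypgeom (n / 2 - l) (n - 1 - l) (n / 2) (r\<^sup>2)"
proof -
  define F0 where "F0 = hypgeom (n / 2 - l) (n - 1 - l) (n / 2)"
  define A where "A = sphere_kernel_integral e l"
  define B where "B = sphere_kernel_integral e (l + 1)"
  \<comment> \<open>\<open>- m\<close> is the exponent of \<open>1 - r\<^sup>2\<close> in the
    claim.\<close>
  define m where "m = 2 * l - n + 1"
  \<comment> \<open>The power for which \<open>s ^ k * E s\<close> below is constant. It is positive
    since the dimension is at least 3, so this constant is its value 0 at the origin.\<close>
  define k where "k = DIM('a) - 2"
  have k: "k > 0" "real k = n - 2" using dim by (auto simp: k_def n_def)
  have "n / 2 > 0" using dim by (simp add: n_def)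
  from hypgeom_ode[OF this, of "n / 2 - l" "n - 1 - l"] obtain F1 F2 where
    F0: "\<And>t. \<bar>t\<bar> < 1 \<Longrightarrow> (F0 has_real_derivative F1 t) (at t)" and
    F1: "\<And>t. \<bar>t\<bar> < 1 \<Longrightarrow> (F1 has_real_derivative F2 t) (at t)" and
    ode: "\<And>t. \<bar>t\<bar> < 1 \<Longrightarrow> t * (1 - t) * F2 t + (n / 2 - (n / 2 - l + (n - 1 - l) + 1) * t) * F1 t
       - (n / 2 - l) * (n - 1 - l) * F0 t = 0"
    unfolding F0_def by metis
  have "\<forall>s. \<exists>D. \<bar>s\<bar> < 1 \<longrightarrow> (A has_real_derivative D) (at s) \<and> s * D = l * ((1 - s\<^sup>2) * B s - A s)"
  proof (intro allI)
    fix s :: real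
    show "\<exists>D. \<bar>s\<bar> < 1 \<longrightarrow> (A has_real_derivative D) (at s) \<and> s * D = l * ((1 - s\<^sup>2) * B s - A s)"
    proof (cases "\<bar>s\<bar> < 1")
      case True
      from sphere_kernel_integral_has_derivative[OF e this, of l] obtain D where
        "(A has_real_derivative D) (at s)" "s * D = - l * A s + l * (1 - s\<^sup>2) * B s"
        unfolding A_def B_def by metis
      then show ?thesis by (intro exI[of _ D]) (simp add: algebra_simps)
    qed simp
  qed
  then obtain A' where A': "\<And>s. \<bar>s\<bar> < 1 \<Longrightarrow> (A has_real_derivative A' s) (at s)"
    "\<And>s. \<bar>s\<bar> < 1 \<Longrightarrow> s * A' s = l * ((1 - s\<^sup>2) * B s - A s)" by metis
  \<comment> \<open>Differentiating \<open>B\<close> produces the integral for \<open>l + 2\<close>;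
    the contiguous relation eliminates it, which closes the system for \<open>A\<close> and
    \<open>B\<close>.\<close>
  have "\<forall>s. \<exists>D. \<bar>s\<bar> < 1 \<longrightarrow> (B has_real_derivative D) (at s) \<and>
    (1 - s\<^sup>2) * (s * D) = (2 * l + 3 - n) * (1 + s\<^sup>2) * B s - (l + 2 - n) * A s - (l + 1) * (1 - s\<^sup>2) * B s"
  proof (intro allI)
    fix s :: real
    show "\<exists>D. \<bar>s\<bar> < 1 \<longrightarrow> (B has_real_derivative D) (at s) \<and>
      (1 - s\<^sup>2) * (s * D) = (2 * l + 3 - n) * (1 + s\<^sup>2) * B s - (l + 2 - n) * A s - (l + 1) * (1 - s\<^sup>2) * B s"
    proof (cases "\<bar>s\<bar> < 1")
      case True
      let ?C = "sphere_kernel_integral e (l + 2) s"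
      have l2: "l + 1 + 1 = l + 2" by simp
      from sphere_kernel_integral_has_derivative[OF e True, of "l + 1"] obtain D where D:
        "(B has_real_derivative D) (at s)" "s * D = - (l + 1) * B s + (l + 1) * (1 - s\<^sup>2) * ?C"
        unfolding B_def l2 by metis
      have C: "(l + 1) * (1 - s\<^sup>2)\<^sup>2 * ?C = (2 * l + 3 - n) * (1 + s\<^sup>2) * B s - (l + 2 - n) * A s"
        using sphere_kernel_integral_contiguous[OF e True, of l] by (simp only: A_def B_def n_def)
      have "(1 - s\<^sup>2) * (s * D) = (l + 1) * (1 - s\<^sup>2)\<^sup>2 * ?C - (l + 1) * (1 - s\<^sup>2) * B s"
        unfolding D(2) by algebra
      with C D(1) show ?thesis by auto
    qed simp
  qed
  then obtain B' where B': "\<And>s. \<bar>s\<bar> < 1 \<Longrightarrow> (B has_real_derivative B' s) (at s)"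
    "\<And>s. \<bar>s\<bar> < 1 \<Longrightarrow> (1 - s\<^sup>2) * (s * B' s)
      = (2 * l + 3 - n) * (1 + s\<^sup>2) * B s - (l + 2 - n) * A s - (l + 1) * (1 - s\<^sup>2) * B s" by metis
  have sq: "\<bar>s\<^sup>2\<bar> < 1" if "\<bar>s\<bar> < 1" for s :: real
    using that by (simp add: abs_square_less_1)
  have dF0: "((\<lambda>s. F0 (s\<^sup>2)) has_real_derivative F1 (s\<^sup>2) * (2 * s)) (at s)" if "\<bar>s\<bar> < 1" for s
    by (rule DERIV_chain2[where f=F0 and g="\<lambda>s. s\<^sup>2", OF F0[OF sq[OF that]]]) (auto intro!: derivative_eq_intros)
  have dF1: "((\<lambda>s. F1 (s\<^sup>2)) has_real_derivative F2 (s\<^sup>2) * (2 * s)) (at s)" if "\<bar>s\<bar> < 1" for s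
    by (rule DERIV_chain2[where f=F1 and g="\<lambda>s. s\<^sup>2", OF F1[OF sq[OF that]]]) (auto intro!: derivative_eq_intros)
  have dw: "((\<lambda>s. 1 - s\<^sup>2) has_real_derivative - (2 * s)) (at s)" for s :: real
    by (auto intro!: derivative_eq_intros)
  text \<open>Up to the factor \<open>s ^ k\<close>, \<open>E\<close> is the Wronskian of \<open>F0 (s\<^sup>2)\<close> and \<open>(1 - s\<^sup>2) powr m * A s\<close>,
    cleared of denominators and powers of \<open>1 - s\<^sup>2\<close>.\<close>
  define E where "E s = 2 * s\<^sup>2 * (1 - s\<^sup>2) * F1 (s\<^sup>2) * A s
     - F0 (s\<^sup>2) * (l * (1 - s\<^sup>2) * ((1 - s\<^sup>2) * B s - A s) - 2 * s\<^sup>2 * m * A s)" for s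
  have E0: "E s = 0" if s: "0 < s" "s < 1" for s
  proof -
    \<comment> \<open>The relations control the derivative only after multiplication by
      \<open>t\<close>. That makes it zero for nonzero \<open>t\<close>, while at 0 its existence
      supplies the continuity of \<open>s ^ k * E s\<close>.\<close>
    have deriv: "\<exists>D. ((\<lambda>s. s ^ k * E s) has_real_derivative D) (at t) \<and> t * D = 0" if t: "\<bar>t\<bar> < 1" for t
    proof -
      define w where "w = 1 - t\<^sup>2"
      define E' where "E' = 4 * t * w * F1 (t\<^sup>2) * A t - 4 * t ^ 3 * F1 (t\<^sup>2) * A t
          + 4 * t ^ 3 * w * F2 (t\<^sup>2) * A t + 2 * t\<^sup>2 * w * F1 (t\<^sup>2) * A' t
          - 2 * t * F1 (t\<^sup>2) * (l * w * (w * B t - A t) - 2 * t\<^sup>2 * m * A t)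
          - F0 (t\<^sup>2) * (l * (- 2 * t) * (w * B t - A t) + l * w * (- 2 * t * B t + w * B' t - A' t)
             - 4 * t * m * A t - 2 * t\<^sup>2 * m * A' t)"
      have "(E has_real_derivative E') (at t)"
        unfolding E_def[abs_def]
        by (rule DERIV_cong, (rule derivative_intros dF0[OF t] dF1[OF t] dw A'(1)[OF t] B'(1)[OF t])+,
          simp add: E'_def w_def, algebra)
      then have "((\<lambda>s. s ^ k * E s) has_real_derivative real k * t ^ (k - 1) * E t + t ^ k * E') (at t)"
        by (auto intro!: derivative_eq_intros)
      moreover have "t * (real k * t ^ (k - 1) * E t + t ^ k * E') = 0"
      proof -
        \<comment> \<open>\<open>X\<close>, \<open>Y\<close> and \<open>Z\<close> are the
          combinations through which the derivatives \<open>A'\<close>, \<open>B'\<close> and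
          \<open>F2\<close> enter \<open>t * E'\<close> and for which the equations give values.
          Substituting them leaves a polynomial identity.\<close>
        define X where "X = t * A' t"
        define Y where "Y = w * (t * B' t)"
        define Z where "Z = t\<^sup>2 * w * F2 (t\<^sup>2)"
        have X: "X = l * (w * B t - A t)" using A'(2)[OF t] by (simp add: X_def w_def)
        have Y: "Y = (2 * l + 3 - n) * (1 + t\<^sup>2) * B t - (l + 2 - n) * A t - (l + 1) * w * B t"
          using B'(2)[OF t] by (simp add: Y_def w_def)
        have Z: "Z = (n / 2 - l) * (n - 1 - l) * F0 (t\<^sup>2) - (n / 2 - (n / 2 - l + (n - 1 - l) + 1) * t\<^sup>2) * F1 (t\<^sup>2)"
          using ode[OF sq[OF t]] by (simp add: Z_def w_def)
        have "t * E' = 4 * t\<^sup>2 * w * F1 (t\<^sup>2) * A t - 4 * t ^ 4 * F1 (t\<^sup>2) * A t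
          + 4 * t\<^sup>2 * Z * A t + 2 * t\<^sup>2 * w * F1 (t\<^sup>2) * X
          - 2 * t\<^sup>2 * F1 (t\<^sup>2) * (l * w * (w * B t - A t) - 2 * t\<^sup>2 * m * A t)
          - F0 (t\<^sup>2) * (l * (- 2 * t\<^sup>2) * (w * B t - A t) + l * (- 2 * t\<^sup>2 * w * B t + w * Y - w * X)
             - 4 * t\<^sup>2 * m * A t - 2 * t\<^sup>2 * m * X)"
          unfolding E'_def X_def Y_def Z_def by algebra
        then have "real k * E t + t * E' = 0"
          unfolding E_def X Y Z m_def k(2) w_def by (simp add: field_simps) algebra
        moreover have "t * (real k * t ^ (k - 1) * E t + t ^ k * E') = t ^ k * (real k * E t + t * E')"
        proof -
          have "t ^ k = t * t ^ (k - 1)" using k(1) by (cases k) auto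
          then show ?thesis by (simp only:) (simp add: algebra_simps)
        qed
        ultimately show ?thesis by simp
      qed
      ultimately show ?thesis by blast
    qed
    have "s ^ k * E s = 0 ^ k * E 0"
    proof (rule DERIV_isconst_end[OF s(1)])
      show "continuous_on {0..s} (\<lambda>s. s ^ k * E s)"
      proof (intro continuous_at_imp_continuous_on ballI)
        fix t assume "t \<in> {0..s}"
        then have "\<bar>t\<bar> < 1" using s by auto
        then show "isCont (\<lambda>s. s ^ k * E s) t" using deriv DERIV_isCont by blast
      qed
      fix t assume t: "0 < t" "t < s"
      then have "\<bar>t\<bar> < 1" using s by auto
      with deriv obtain D where "((\<lambda>s. s ^ k * E s) has_real_derivative D) (at t)" "t * D = 0" by blast
      with t show "((\<lambda>s. s ^ k * E s) has_real_derivative 0) (at t)" by simp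
    qed
    also have "\<dots> = 0" using k(1) by (simp add: zero_power)
    finally show ?thesis using s by (simp add: mult_eq_0_iff)
  qed
  define Q where "Q s = F0 (s\<^sup>2) * (1 - s\<^sup>2) powr (- m) / A s" for s
  have Apos: "A s > 0" if "\<bar>s\<bar> < 1" for s
    unfolding A_def by (rule sphere_kernel_integral_pos[OF e that])
  have dQ: "(Q has_real_derivative ((F1 (s\<^sup>2) * (2 * s) * (1 - s\<^sup>2) powr (- m)
      + F0 (s\<^sup>2) * (2 * s * m * (1 - s\<^sup>2) powr (- m - 1))) * A s
      - F0 (s\<^sup>2) * (1 - s\<^sup>2) powr (- m) * A' s) / (A s * A s)) (at s)" if s: "\<bar>s\<bar> < 1" for s
  proof -
    have w: "1 - s\<^sup>2 > 0" using sq[OF s] by simp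
    have "((\<lambda>s. (1 - s\<^sup>2) powr (- m)) has_real_derivative 2 * s * m * (1 - s\<^sup>2) powr (- m - 1)) (at s)"
      using DERIV_fun_powr[OF dw w, of "- m"] by (simp add: mult_ac)
    from DERIV_divide[OF DERIV_mult[OF dF0[OF s] this] A'(1)[OF s]] Apos[OF s]
    show ?thesis unfolding Q_def[abs_def] by (simp add: add.commute mult.commute)
  qed
  have "Q r = 1"
  proof (cases "r = 0")
    case True
    then show ?thesis by (simp add: Q_def F0_def A_def sphere_kernel_integral_0)
  next
    case False
    with r have r0: "0 < r" by simp
    have "Q r = Q 0"
    proof (rule DERIV_isconst_end[OF r0])
      show "continuous_on {0..r} Q"
      proof (intro continuous_at_imp_continuous_on ballI)
        fix t assume "t \<in> {0..r}"
        then have "\<bar>t\<bar> < 1" using r by auto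
        from DERIV_isCont[OF dQ[OF this]] show "isCont Q t" .
      qed
      fix s assume s: "0 < s" "s < r"
      then have s1: "\<bar>s\<bar> < 1" using r by auto
      define w where "w = 1 - s\<^sup>2"
      have w: "w > 0" using sq[OF s1] by (simp add: w_def)
      define P where "P = w powr (- m - 1)"
      have P: "w powr (- m) = w * P"
        using w powr_mult_base[of w "- m - 1"] by (simp add: P_def)
      define num where "num = (F1 (s\<^sup>2) * (2 * s) * (w * P) + F0 (s\<^sup>2) * (2 * s * m * P)) * A s
        - F0 (s\<^sup>2) * (w * P) * A' s"
      \<comment> \<open>The numerator of the derivative of \<open>Q\<close>, multiplied by
        \<open>s\<close>, is a multiple of \<open>E s\<close> and hence zero.\<close>
      have "s * num = P * (2 * s\<^sup>2 * w * F1 (s\<^sup>2) * A s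
          - F0 (s\<^sup>2) * (w * (s * A' s) - 2 * s\<^sup>2 * m * A s))"
        unfolding num_def by algebra
      also have "\<dots> = P * E s"
        unfolding A'(2)[OF s1] E_def w_def by algebra
      finally have "num = 0" using E0[of s] s r by simp
      with dQ[OF s1] show "(Q has_real_derivative 0) (at s)"
        by (simp add: num_def P flip: w_def P_def)
    qed
    also have "Q 0 = 1" by (simp add: Q_def F0_def A_def sphere_kernel_integral_0)
    finally show ?thesis .
  qed
  then have "A r = (1 - r\<^sup>2) powr (- m) * F0 (r\<^sup>2)"
    using Apos[of r] r by (simp add: Q_def field_simps)
  then show ?thesis by (simp add: A_def F0_def m_def algebra_simps)
qed

section \<open>Duality\<close>

text \<open>Young's inequality is applied to the functions divided by their norms and then
  integrated; the same pointwise bound gives integrability of the product. If one of the norms is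
  zero, the product vanishes almost everywhere.\<close>

lemma Holder_integral:
  fixes f g :: "'b \<Rightarrow> real"
  assumes pq: "p > 1" "q > 1" "1 / p + 1 / q = 1"
    and [measurable]: "f \<in> borel_measurable M" "g \<in> borel_measurable M"
    and nonneg: "\<And>x. 0 \<le> f x" "\<And>x. 0 \<le> g x"
    and int: "integrable M (\<lambda>x. f x powr p)" "integrable M (\<lambda>x. g x powr q)"
  shows "(\<integral>x. f x * g x \<partial>M) \<le> (\<integral>x. f x powr p \<partial>M) powr (1 / p) * (\<integral>x. g x powr q \<partial>M) powr (1 / q)"
proof -
  define F where "F = (\<integral>x. f x powr p \<partial>M)"
  define G where "G = (\<integral>x. g x powr q \<partial>M)"
  have FG: "F \<ge> 0" "G \<ge> 0" by (simp_all add: F_def G_def)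
  have "(\<integral>x. f x * g x \<partial>M) = 0" if "F = 0 \<or> G = 0"
  proof -
    from that have "AE x in M. f x powr p = 0 \<or> g x powr q = 0"
      unfolding F_def G_def
      by (subst (asm) (1 2) integral_nonneg_eq_0_iff_AE) (auto simp: int elim: eventually_mono)
    then have "AE x in M. f x * g x = 0" by eventually_elim auto
    then have "(\<integral>x. f x * g x \<partial>M) = (\<integral>x. 0 \<partial>M)" by (intro integral_cong_AE) auto
    then show ?thesis by simp
  qed
  moreover have "(\<integral>x. f x * g x \<partial>M) \<le> F powr (1 / p) * G powr (1 / q)" if "F \<noteq> 0" "G \<noteq> 0"
  proof -
    from that FG have pos: "F > 0" "G > 0" by auto
    let ?s = "F powr (1 / p) * G powr (1 / q)"
    have young: "f x * g x \<le> ?s * (f x powr p / (F * p) + g x powr q / (G * q))" for x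
    proof -
      have "f x / F powr (1 / p) * (g x / G powr (1 / q))
          \<le> (f x / F powr (1 / p)) powr p / p + (g x / G powr (1 / q)) powr q / q"
        by (intro Youngs_inequality pq divide_nonneg_nonneg nonneg) simp_all
      also have "\<dots> = f x powr p / (F * p) + g x powr q / (G * q)"
        using pos pq nonneg by (simp add: powr_divide powr_powr)
      finally have "?s * (f x / F powr (1 / p) * (g x / G powr (1 / q)))
          \<le> ?s * (f x powr p / (F * p) + g x powr q / (G * q))"
        by (intro mult_left_mono) simp_all
      then show ?thesis using pos by simp
    qed
    have "(\<integral>x. f x * g x \<partial>M) \<le> (\<integral>x. ?s * (f x powr p / (F * p) + g x powr q / (G * q)) \<partial>M)"
    proof (rule integral_mono)
      show i: "integrable M (\<lambda>x. ?s * (f x powr p / (F * p) + g x powr q / (G * q)))"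
        using int by simp
      show "integrable M (\<lambda>x. f x * g x)"
        by (rule Bochner_Integration.integrable_bound[OF i])
          (use young nonneg in \<open>auto intro!: AE_I2 order_trans[OF young abs_ge_self]\<close>)
    qed (rule young)
    also have "\<dots> = ?s * (F / (F * p) + G / (G * q))"
      using int by (simp add: F_def G_def)
    also have "\<dots> = ?s" using pos pq(3) by simp
    finally show ?thesis .
  qed
  ultimately show ?thesis unfolding F_def G_def by fastforce
qed

context prob_space begin

text \<open>As the total mass is not zero, the essential supremum of the constant 0 is 0. The
  essential supremum of the norm is thus finite and nonnegative, and \<open>real_of_ereal\<close>
  loses nothing.\<close>

lemma in_Lp_infinity_bound:
  fixes f :: "'a \<Rightarrow> 'c::{real_normed_vector, second_countable_topology}"
  assumes "in_Lp M \<infinity> f"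
  shows "AE y in M. norm (f y) \<le> Lp_norm M \<infinity> f" "Lp_norm M \<infinity> f \<ge> 0"
proof -
  let ?S = "esssup M (\<lambda>y. ereal (norm (f y)))"
  have [measurable]: "f \<in> borel_measurable M" and fin: "?S < \<infinity>"
    using assms by (auto simp: in_Lp_def)
  have AE: "AE y in M. ereal (norm (f y)) \<le> ?S" by (rule esssup_AE)
  have "esssup M (\<lambda>_. 0) \<le> ?S" by (rule esssup_mono) simp_all
  moreover have "esssup M (\<lambda>_. 0 :: ereal) = 0"
    by (rule esssup_const) (simp add: emeasure_space_1)
  ultimately have "?S \<ge> 0" by simp
  with fin obtain s where s: "?S = ereal s" "s \<ge> 0" by (cases ?S) auto
  then have "Lp_norm M \<infinity> f = s" by (simp add: Lp_norm_def)
  with s AE show "AE y in M. norm (f y) \<le> Lp_norm M \<infinity> f" "Lp_norm M \<infinity> f \<ge> 0" by auto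
qed

text \<open>For finite \<open>p\<close> this is Hoelder's inequality, with integrability of the
  power of \<open>k\<close> coming from its essential bound. For \<open>p = \<infinity>\<close> the
  conjugate exponent is 1 and the essential bound on \<open>f\<close> is pulled out of the
  integral.\<close>

lemma norm_integral_le_Lp_norm:
  fixes f :: "'a \<Rightarrow> 'c::euclidean_space" and k :: "'a \<Rightarrow> real"
  assumes p: "1 < p" and f: "in_Lp M p f"
    and k[measurable]: "k \<in> borel_measurable M" and kB: "\<And>y. 0 \<le> k y" "AE y in M. k y \<le> B"
  shows "norm (\<integral>y. k y *\<^sub>R f y \<partial>M) \<le> (\<integral>y. k y powr conj_exp p \<partial>M) powr (1 / conj_exp p) * Lp_norm M p f"
proof -
  have [measurable]: "f \<in> borel_measurable M" using f by (simp add: in_Lp_def)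
  have "norm (\<integral>y. k y *\<^sub>R f y \<partial>M) \<le> (\<integral>y. norm (k y *\<^sub>R f y) \<partial>M)" by (rule integral_norm_bound)
  also have "\<dots> = (\<integral>y. k y * norm (f y) \<partial>M)" using kB by simp
  also have "\<dots> \<le> (\<integral>y. k y powr conj_exp p \<partial>M) powr (1 / conj_exp p) * Lp_norm M p f"
  proof (cases "p = \<infinity>")
    case True
    note L = in_Lp_infinity_bound[OF f[unfolded True]]
    have ik: "integrable M k" using kB by (intro integrable_const_bound[of _ B]) auto
    have "(\<integral>y. k y * norm (f y) \<partial>M) \<le> (\<integral>y. k y * Lp_norm M \<infinity> f \<partial>M)"
      using L kB ik
      by (intro integral_mono_AE' integrable_mult_left) (auto elim!: eventually_mono intro!: mult_left_mono)
    then show ?thesis using True kB by (simp add: conj_exp_def)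
  next
    case False
    with p obtain r where r: "p = ereal r" "r > 1" by (cases p) auto
    have "(\<integral>y. k y * norm (f y) \<partial>M)
      \<le> (\<integral>y. k y powr conj_exp p \<partial>M) powr (1 / conj_exp p) * (\<integral>y. norm (f y) powr r \<partial>M) powr (1 / r)"
    proof (rule Holder_integral)
      show "1 < conj_exp p" "1 / conj_exp p + 1 / r = 1"
        using r by (auto simp: conj_exp_def field_simps)
      have "AE y in M. k y powr conj_exp p \<le> B powr conj_exp p"
        using kB(2) by eventually_elim (use kB(1) \<open>1 < conj_exp p\<close> in \<open>auto intro!: powr_mono2\<close>)
      then show "integrable M (\<lambda>y. k y powr conj_exp p)"
        by (intro integrable_const_bound) auto
      show "integrable M (\<lambda>y. norm (f y) powr r)" using f r by (simp add: in_Lp_def)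
    qed (use r kB in auto)
    then show ?thesis using r by (simp add: Lp_norm_def)
  qed
  finally show ?thesis .
qed

text \<open>The extremal function is \<open>k powr (q - 1)\<close> times \<open>v\<close>, or
  constantly \<open>v\<close> if \<open>p = \<infinity>\<close>. As its direction is fixed, taking
  norms inside the integral loses nothing.\<close>

lemma norm_integral_eq_Lp_norm:
  fixes k :: "'a \<Rightarrow> real" and v :: "'c::euclidean_space"
  assumes p: "1 < p" and k[measurable]: "k \<in> borel_measurable M"
    and kpos: "\<And>y. 0 \<le> k y" "AE y in M. k y \<le> B" "(\<integral>y. k y powr conj_exp p \<partial>M) > 0" and v: "norm v = 1"
  obtains f :: "'a \<Rightarrow> 'c" where "in_Lp M p f" "Lp_norm M p f > 0"
    "norm (\<integral>y. k y *\<^sub>R f y \<partial>M) = (\<integral>y. k y powr conj_exp p \<partial>M) powr (1 / conj_exp p) * Lp_norm M p f"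
proof (cases "p = \<infinity>")
  case True
  have "esssup M (\<lambda>_. ereal 1) = ereal 1"
    by (rule esssup_const) (simp add: emeasure_space_1)
  then have "in_Lp M p (\<lambda>_. v)" "Lp_norm M p (\<lambda>_. v) = 1"
    using True v by (simp_all add: in_Lp_def Lp_norm_def)
  moreover have "norm (\<integral>y. k y *\<^sub>R v \<partial>M) = (\<integral>y. k y powr conj_exp p \<partial>M) powr (1 / conj_exp p)"
  proof -
    have "integrable M k" using kpos by (intro integrable_const_bound[of _ B]) auto
    then have "norm (\<integral>y. k y *\<^sub>R v \<partial>M) = \<bar>\<integral>y. k y \<partial>M\<bar>" using v by simp
    then show ?thesis using True kpos by (simp add: conj_exp_def)
  qed
  ultimately show thesis by (intro that[of "\<lambda>_. v"]) auto
next
  case False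
  with p obtain r where r: "p = ereal r" "r > 1" by (cases p) auto
  define q where "q = conj_exp p"
  define I where "I = (\<integral>y. k y powr q \<partial>M)"
  have q: "q > 1" "(q - 1) * r = q" "1 / q + 1 / r = 1"
    using r by (auto simp: q_def conj_exp_def field_simps)
  have I: "I > 0" using kpos by (simp add: I_def q_def)
  have AE: "AE y in M. k y powr q \<le> B powr q"
    using kpos(2) by eventually_elim (use kpos(1) q in \<open>auto intro!: powr_mono2\<close>)
  have int: "integrable M (\<lambda>y. k y powr q)"
    using AE by (intro integrable_const_bound) auto
  let ?f = "\<lambda>y. k y powr (q - 1) *\<^sub>R v"
  \<comment> \<open>By \<open>(q - 1) * r = q\<close>, both the pairing with \<open>k\<close> and
    the \<open>r\<close>-th power of the norm of \<open>?f\<close> integrate to \<open>I\<close>;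
    splitting \<open>I\<close> with exponents \<open>1 / q\<close> and \<open>1 / r\<close> gives
    the equality.\<close>
  have nf: "norm (?f y) powr r = k y powr q" for y using v q by (simp add: powr_powr)
  have L: "Lp_norm M p ?f = I powr (1 / r)"
    unfolding Lp_norm_def using r by (simp add: nf[simplified] I_def v powr_powr q)
  have kf: "k y *\<^sub>R ?f y = k y powr q *\<^sub>R v" for y
    using kpos(1)[of y] powr_mult_base[of "k y" "q - 1"] by simp
  have "norm (\<integral>y. k y *\<^sub>R ?f y \<partial>M) = I"
    unfolding kf using int I v by (simp add: I_def)
  also have "I = I powr (1 / q + 1 / r)" using q(3) I by simp
  also have "\<dots> = I powr (1 / q) * Lp_norm M p ?f" by (simp only: powr_add L)
  finally have "norm (\<integral>y. k y *\<^sub>R ?f y \<partial>M) = I powr (1 / q) * Lp_norm M p ?f" .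
  moreover have "in_Lp M p ?f"
    unfolding in_Lp_def using r int by (simp add: v powr_powr q)
  ultimately show thesis
    using I L by (intro that[of ?f]) (auto simp: I_def q_def)
qed

end

section \<open>The sharp pointwise estimate\<close>

lemma norm_diff_sphere:
  fixes e \<eta> :: "'a::real_inner"
  assumes "norm e = 1" "norm \<eta> = 1"
  shows "(norm (r *\<^sub>R e - \<eta>))\<^sup>2 = 1 + r\<^sup>2 - 2 * r * (e \<bullet> \<eta>)"
proof -
  have "(norm (r *\<^sub>R e - \<eta>))\<^sup>2 = r\<^sup>2 * (e \<bullet> e) - 2 * r * (e \<bullet> \<eta>) + \<eta> \<bullet> \<eta>"
    unfolding power2_norm_eq_inner
    by (simp add: inner_diff_left inner_diff_right inner_commute[of \<eta> e] power2_eq_square algebra_simps)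
  then show ?thesis using assms by (simp add: norm_eq_1)
qed

theorem theorem1p3:
  fixes \<phi> :: "'a::euclidean_space \<Rightarrow> 'a" and p :: ereal and \<alpha> \<beta> :: real
  assumes "DIM('a) \<ge> 3"
    and "1 < p"
    and "real DIM('a) + \<alpha> = \<beta> + 1"
    and "\<beta> \<ge> real DIM('a)"
    and "in_Lp sphere_measure p \<phi>"
  shows "(\<forall>x\<in>ball 0 1. norm (u_ab \<alpha> \<beta> \<phi> x)
            \<le> C_p (real DIM('a)) p \<beta> x / (1 - (norm x)\<^sup>2) powr ((real DIM('a) - 1) * inv_exp p)
               * Lp_norm sphere_measure p \<phi>) \<and>
         (\<forall>x\<in>ball (0::'a) 1. \<exists>\<psi> :: 'a \<Rightarrow> 'a. in_Lp sphere_measure p \<psi> \<and> Lp_norm sphere_measure p \<psi> > 0 \<and>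
            norm (u_ab \<alpha> \<beta> \<psi> x)
              = C_p (real DIM('a)) p \<beta> x / (1 - (norm x)\<^sup>2) powr ((real DIM('a) - 1) * inv_exp p)
                 * Lp_norm sphere_measure p \<psi>)"
proof -
  interpret prob_space "sphere_measure :: 'a measure" by (rule prob_space_sphere_measure)
  define n where "n = real DIM('a)"
  define q where "q = conj_exp p"
  have n: "n \<ge> 3" using assms(1) by (simp add: n_def)
  have q: "q \<ge> 1" "(q - 1) / q = inv_exp p"
    using assms(2) by (cases p; auto simp: q_def conj_exp_def inv_exp_def field_simps)+
  \<comment> \<open>All four arguments of \<open>Gamma\<close> are positive because
    \<open>\<beta> \<ge> n\<close>.\<close>
  have c: "c_const n \<beta> > 0"
    using assms(4) n unfolding c_const_def by (auto simp: n_def intro!: divide_pos_pos mult_pos_pos Gamma_real_pos)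
  define K where "K x \<eta> = (1 - (norm x)\<^sup>2) powr \<alpha> / norm (x - \<eta>) powr \<beta>" for x \<eta> :: 'a
  have u: "norm (u_ab \<alpha> \<beta> f x) = c_const n \<beta> * norm (\<integral>\<eta>. K x \<eta> *\<^sub>R f \<eta> \<partial>sphere_measure)" for f x
    using c by (simp add: u_ab_def K_def n_def)
  have Kcont: "continuous_on (sphere 0 1) (K x)" if "x \<in> ball 0 1" for x
  proof -
    have "norm (x - \<eta>) \<noteq> 0" if "\<eta> \<in> sphere 0 1" for \<eta>
      using that \<open>x \<in> ball 0 1\<close> by auto
    then show ?thesis unfolding K_def by (intro continuous_intros ballI) auto
  qed
  have Kmeas: "K x \<in> borel_measurable sphere_measure" if "x \<in> ball 0 1" for x
    by (rule sphere_continuous_measurable[OF Kcont[OF that]])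
  have Knonneg: "0 \<le> K x \<eta>" for x \<eta> by (simp add: K_def)
  have Kbound: "\<exists>B. AE \<eta> in sphere_measure. K x \<eta> \<le> B" if "x \<in> ball 0 1" for x
  proof -
    have "bounded (K x ` sphere 0 1)"
      by (intro compact_imp_bounded compact_continuous_image Kcont that) simp
    then obtain B where "\<forall>\<eta>\<in>sphere 0 1. \<bar>K x \<eta>\<bar> \<le> B" by (auto simp: bounded_iff)
    then show ?thesis by (intro exI[of _ B] AE_I2) (auto simp: abs_le_iff)
  qed
  \<comment> \<open>The power \<open>K x \<eta> powr q\<close> is a weight times the kernel with
    \<open>l = q * \<beta> / 2\<close>. With \<open>\<alpha> = \<beta> + 1 - n\<close> the exponents
    of \<open>1 - (norm x)\<^sup>2\<close> add up to \<open>- (n - 1) * (q - 1)\<close>, and the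
    root of order \<open>q\<close> turns this into \<open>- (n - 1) * inv_exp p\<close>.\<close>
  have KI: "(\<integral>\<eta>. K x \<eta> powr q \<partial>sphere_measure) > 0 \<and>
     c_const n \<beta> * (\<integral>\<eta>. K x \<eta> powr q \<partial>sphere_measure) powr (1 / q)
      = C_p n p \<beta> x / (1 - (norm x)\<^sup>2) powr ((n - 1) * inv_exp p)" if x: "x \<in> ball 0 1" for x
  proof -
    define r where "r = norm x"
    define w where "w = 1 - r\<^sup>2"
    define l where "l = q * \<beta> / 2"
    define F where "F = hypgeom (n / 2 - l) (n - 1 - l) (n / 2) (r\<^sup>2)"
    have r: "0 \<le> r" "r < 1" "\<bar>r\<bar> < 1" using x by (auto simp: r_def)
    then have w: "w > 0" by (simp add: w_def abs_square_less_1)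
    \<comment> \<open>The centre has no direction of its own; there any unit vector works, as
      \<open>r = 0\<close>.\<close>
    obtain e where e: "norm e = 1" "x = r *\<^sub>R e"
    proof (cases "x = 0")
      case True
      then show ?thesis using that[of "SOME b. b \<in> Basis"] by (simp add: r_def some_in_eq)
    next
      case False
      then show ?thesis using that[of "x /\<^sub>R norm x"] by (simp add: r_def)
    qed
    have "(\<integral>\<eta>. K x \<eta> powr q \<partial>sphere_measure)
        = (\<integral>\<eta>. w powr (q * \<alpha>) * (1 + r\<^sup>2 - 2 * r * (e \<bullet> \<eta>)) powr (-l) \<partial>sphere_measure)"
    proof (rule Bochner_Integration.integral_cong[OF refl])
      fix \<eta> :: 'a assume "\<eta> \<in> space sphere_measure"
      then have \<eta>: "norm \<eta> = 1" by simp
      have "norm (x - \<eta>) > 0" using r \<eta> by (auto simp: r_def)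
      then have "norm (x - \<eta>) powr (q * \<beta>) = ((norm (x - \<eta>)) powr 2) powr l"
        by (simp only: powr_powr) (simp add: l_def)
      also have "\<dots> = (1 + r\<^sup>2 - 2 * r * (e \<bullet> \<eta>)) powr l"
        using norm_diff_sphere[OF e(1) \<eta>, of r] \<open>norm (x - \<eta>) > 0\<close> e(2) by simp
      finally show "K x \<eta> powr q = w powr (q * \<alpha>) * (1 + r\<^sup>2 - 2 * r * (e \<bullet> \<eta>)) powr (-l)"
        unfolding K_def by (simp add: powr_divide powr_powr w_def r_def powr_minus_divide mult.commute[of _ q])
    qed
    also have "\<dots> = w powr (q * \<alpha>) * sphere_kernel_integral e l r"
      by (simp add: sphere_kernel_integral_def)
    also have "\<dots> = w powr (q * \<alpha> + (n - 1 - 2 * l)) * F"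
      unfolding sphere_kernel_integral_hypgeom[OF assms(1) e(1) r(1,2)]
      by (simp add: powr_add F_def n_def w_def)
    also have "q * \<alpha> + (n - 1 - 2 * l) = - ((n - 1) * (q - 1))"
    proof -
      have \<alpha>: "\<alpha> = \<beta> + 1 - n" using assms(3) by (simp add: n_def)
      show ?thesis unfolding \<alpha> l_def by (simp add: algebra_simps)
    qed
    finally have I: "(\<integral>\<eta>. K x \<eta> powr q \<partial>sphere_measure) = w powr (- ((n - 1) * (q - 1))) * F" .
    \<comment> \<open>The terms of the series need not all be positive, so the sign is read off from
      the integral.\<close>
    have F: "F > 0"
    proof -
      have "0 < w powr (n - 1 - 2 * l) * F"
        using sphere_kernel_integral_pos[OF e(1) r(3), of l]
        unfolding sphere_kernel_integral_hypgeom[OF assms(1) e(1) r(1,2)] by (simp add: F_def n_def w_def)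
      then show ?thesis using w by (simp add: zero_less_mult_iff)
    qed
    have C: "C_p n p \<beta> x = c_const n \<beta> * F powr (1 / q)"
      by (simp add: C_p_def F_def l_def r_def q_def diff_divide_distrib)
    have "- ((n - 1) * (q - 1)) * (1 / q) = - ((n - 1) * inv_exp p)"
      by (simp flip: q(2))
    then have "(w powr (- ((n - 1) * (q - 1))) * F) powr (1 / q) = w powr (- ((n - 1) * inv_exp p)) * F powr (1 / q)"
      using F by (simp only: powr_mult powr_ge_zero less_imp_le powr_powr)
    also have "\<dots> = F powr (1 / q) / w powr ((n - 1) * inv_exp p)"
      by (simp add: powr_minus_divide)
    finally show ?thesis
      unfolding I C using F w by (simp add: w_def r_def)
  qed
  show ?thesis
  proof (intro conjI ballI)
    fix x :: 'a assume x: "x \<in> ball 0 1"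
    obtain B where B: "AE \<eta> in sphere_measure. K x \<eta> \<le> B" using Kbound[OF x] by blast
    have "norm (u_ab \<alpha> \<beta> \<phi> x)
        \<le> c_const n \<beta> * ((\<integral>\<eta>. K x \<eta> powr q \<partial>sphere_measure) powr (1 / q) * Lp_norm sphere_measure p \<phi>)"
      unfolding u q_def using c
      by (intro mult_left_mono norm_integral_le_Lp_norm[OF assms(2,5) Kmeas[OF x] Knonneg B]) simp
    then show "norm (u_ab \<alpha> \<beta> \<phi> x)
      \<le> C_p (real DIM('a)) p \<beta> x / (1 - (norm x)\<^sup>2) powr ((real DIM('a) - 1) * inv_exp p)
        * Lp_norm sphere_measure p \<phi>"
      using KI[OF x] by (simp only: mult.assoc[symmetric] n_def)
  next
    fix x :: 'a assume x: "x \<in> ball 0 1"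
    obtain B where B: "AE \<eta> in sphere_measure. K x \<eta> \<le> B" using Kbound[OF x] by blast
    obtain v :: 'a where v: "norm v = 1" using vector_choose_size[of 1] by auto
    obtain \<psi> :: "'a \<Rightarrow> 'a" where \<psi>: "in_Lp sphere_measure p \<psi>" "Lp_norm sphere_measure p \<psi> > 0"
      "norm (\<integral>\<eta>. K x \<eta> *\<^sub>R \<psi> \<eta> \<partial>sphere_measure)
        = (\<integral>\<eta>. K x \<eta> powr q \<partial>sphere_measure) powr (1 / q) * Lp_norm sphere_measure p \<psi>"
      using norm_integral_eq_Lp_norm[OF assms(2) Kmeas[OF x] Knonneg B _ v] KI[OF x] unfolding q_def by metis
    have "norm (u_ab \<alpha> \<beta> \<psi> x)
        = C_p (real DIM('a)) p \<beta> x / (1 - (norm x)\<^sup>2) powr ((real DIM('a) - 1) * inv_exp p)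
          * Lp_norm sphere_measure p \<psi>"
      unfolding u \<psi>(3) using KI[OF x] by (simp only: mult.assoc[symmetric] n_def)
    with \<psi> show "\<exists>\<psi> :: 'a \<Rightarrow> 'a. in_Lp sphere_measure p \<psi> \<and> Lp_norm sphere_measure p \<psi> > 0 \<and>
      norm (u_ab \<alpha> \<beta> \<psi> x)
        = C_p (real DIM('a)) p \<beta> x / (1 - (norm x)\<^sup>2) powr ((real DIM('a) - 1) * inv_exp p)
          * Lp_norm sphere_measure p \<psi>" by blast
  qed
qed

end
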